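(* Consider the nonlinear dynamic program and the AOTD algorithm described in the context. Suppose the reduced-Hessian lower bound, uniform controllability, uniform boundedness, and compactness/smoothness assumptions (all spelled out in the context, with constants $\gamma_{\rm RH},\gamma_C,t_C,\Upsilon_{\rm Upper}$) hold, and let $\mu\ge\bar\mu:=32\,\Upsilon_{\rm Upper}^{4t_C+1}/\gamma_C$. Then the (infinite sequence of) iterates generated by AOTD satisfies: (1) For every $\tau\ge 0$ there exists a step size $\alpha^\tau\in(0,1]$ satisfying the Armijo condition $$\mathcal L_{\bm\eta^\tau}\big(\bm z^\tau+\alpha^\tau\Delta\tilde{\bm z}^\tau,\ \bm\lambda^\tau+\alpha^\tau\Delta\tilde{\bm\lambda}^\tau\big)\le \mathcal L_{\bm\eta^\tau}^\tau+\alpha^\tau\beta\,(\nabla\mathcal L_{\bm\eta^\tau}^\tau)^T\begin{pmatrix}\Delta\tilde{\bm z}^\tau\\ \Delta\tilde{\bm\lambda}^\tau\end{pmatrix}.$$ (2) The KKT residual satisfies $\|\nabla\mathcal L^\tau\|\to0$ as $\tau\to\infty$.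
   Context: **Notation.** $\|\cdot\|$ is the Euclidean norm of vectors and spectral norm of matrices; $\sigma_{\min}$ is the smallest singular value; $\mathbb I$ the identity; $(\bm x;\bm y)$ vertical concatenation. Stages are indexed by subscripts, iterations by superscripts $\tau$. **Problem.** Integers $N,n_x,n_u\ge1$, $\bar{\bm x}_0\in\mathbb R^{n_x}$, functions $g_k:\mathbb R^{n_x}\times\mathbb R^{n_u}\to\mathbb R$, $f_k:\mathbb R^{n_x}\times\mathbb R^{n_u}\to\mathbb R^{n_x}$ ($0\le k\le N-1$), $g_N:\mathbb R^{n_x}\to\mathbb R$. The problem is to minimize $\sum_{k=0}^{N-1}g_k(\bm x_k,\bm u_k)+g_N(\bm x_N)$ subject to $\bm x_0=\bar{\bm x}_0$, $\bm x_{k+1}=f_k(\bm x_k,\bm u_k)$. Put $\bm z_k=(\bm x_k;\bm u_k)$ for $k<N$, $\bm z_N=\bm x_N$, $\bm z=(\bm z_0;\dots;\bm z_N)$; $g(\bm z)$ is the total cost, $f(\bm z)=(\bm x_0-\bar{\bm x}_0;\ \bm x_1-f_0(\bm x_0,\bm u_0);\dots;\bm x_N-f_{N-1}(\bm x_{N-1},\bm u_{N-1}))$, $\bm\lambda=(\bm\lambda_0;\dots;\bm\lambda_N)$ with $\bm\lambda_k\in\mathbb R^{n_x}$, $\mathcal L(\bm z,\bm\lambda)=g(\bm z)+\bm\lambda^Tf(\bm z)$, $\nabla\mathcal L=(\nabla_{\bm z}\mathcal L;\nabla_{\bm\lambda}\mathcal L)$. A superscript $\tau$ denotes evaluation at $(\bm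 z^\tau,\bm\lambda^\tau)$. $A_k,B_k$ are the Jacobians of $f_k$ in $\bm x_k,\bm u_k$; $G$ is the Jacobian of $f$; $H=\nabla^2_{\bm z}\mathcal L=\mathrm{diag}(H_0,\dots,H_N)$, where $H_k$ depends on $(\bm z_k,\bm\lambda_{k+1})$ for $k<N$ and $H_N$ on $\bm z_N$. $\hat H^\tau=\mathrm{diag}(\hat H_0^\tau,\dots,\hat H_N^\tau)$ is a symmetric modification of $H^\tau$ with the same block structure, $\hat H_k^\tau=\begin{pmatrix}\hat Q_k&\hat S_k^T\\ \hat S_k&\hat R_k\end{pmatrix}$ ($k<N$), $\hat H_N^\tau=\hat Q_N$, with $\hat H^\tau=H^\tau$ whenever $H^\tau$ itself satisfies the reduced-Hessian lower bound below. $\Gamma^\tau=\begin{pmatrix}\hat H^\tau&(G^\tau)^T\\ G^\tau&\bm0\end{pmatrix}$. The exact Newton direction $(\Delta\bm z^\tau,\Delta\bm\lambda^\tau)$ solves $\Gamma^\tau(\Delta\bm z^\tau;\Delta\bm\lambda^\tau)=-\nabla\mathcal L^\tau$. **Merit function.** For $\bm\eta=(\eta_1,\eta_2)$ positive, $\mathcal L_{\bm\eta}=\mathcal L+\frac{\eta_1}2\|\nabla_{\bm\lambda}\mathcal L\|^2+\frac{\eta_2}2\|\nabla_{\bm z}\mathcal L\|^2$; $\mathcal L^\tau_{\bm\eta}=\mathcal L_{\bm\eta}(\bm z^\tau,\bm\lambda^\tau)$. **Decomposition.** $M\in\{1,\dots,N\}$, knots $0=n_0<\dots<n_M=N$, cores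 $\mathcal K_i=\{n_i,\dots,n_{i+1}-1\}$ for $i<M-1$ and $\mathcal K_{M-1}=\{n_{M-1},\dots,N\}$. Given nominal overlap $b_i\in\mathbb Z_{\ge1}$, subproblem $i\in\{0,\dots,M-1\}$ has window $[m_1,m_2]$, $m_1=m_1^i=\max\{n_i-b_i,0\}$, $m_2=m_2^i=\min\{n_{i+1}+b_i,N\}$. With a fixed $\mu>0$, the local quadratic program at iteration $\tau$, in $\bm p_k\in\mathbb R^{n_x}$ ($m_1\le k\le m_2$), $\bm q_k\in\mathbb R^{n_u}$ ($m_1\le k<m_2$), minimizes $$\sum_{k=m_1}^{m_2-1}\Big\{\tfrac12\begin{pmatrix}\bm p_k\\\bm q_k\end{pmatrix}^T\hat H_k^\tau\begin{pmatrix}\bm p_k\\\bm q_k\end{pmatrix}+(\nabla_{\bm x_k}\mathcal L^\tau)^T\bm p_k+(\nabla_{\bm u_k}\mathcal L^\tau)^T\bm q_k\Big\}+\tfrac12\bm p_{m_2}^T\hat H_{\rm T}\bm p_{m_2}+(\nabla_{\bm x_{m_2}}\mathcal L^\tau)^T\bm p_{m_2},$$ $\hat H_{\rm T}=\hat Q_{m_2}+\mu\mathbb I$ if $m_2<N$ and $\hat Q_N$ if $m_2=N$, subject to $\bm p_{m_1}=\bm d_1$ and $\bm p_{k+1}=A_k^\tau\bm p_k+B_k^\tau\bm q_k-\nabla_{\bm\lambda_{k+1}}\mathcal L^\tau$ for $m_1\le k<m_2$, where $\bm d_1=\bar{\bm x}_0-\bm x_0^\tau$ if $m_1=0$ and $\bm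 d_1=\bm0$ otherwise. Let $\tilde{\bm\omega}$ stack the $\bm p_k,\bm q_k$ and $\tilde{\bm\zeta}=(\bm\zeta_{m_1};\dots;\bm\zeta_{m_2})$ stack the multipliers (Lagrangian = objective $+\bm\zeta_{m_1}^T(\bm p_{m_1}-\bm d_1)+\sum_k\bm\zeta_{k+1}^T(\bm p_{k+1}-A_k^\tau\bm p_k-B_k^\tau\bm q_k+\nabla_{\bm\lambda_{k+1}}\mathcal L^\tau)$). The KKT system is $\Gamma_i^\tau(\tilde{\bm\omega};\tilde{\bm\zeta})=-\nabla\mathcal L^{(i),\tau}_{\rm QP}$, where $\nabla\mathcal L^{(i),\tau}_{\rm QP}$ is the gradient of this Lagrangian at $(\bm0,\bm0)$ and $\Gamma_i^\tau$ its Hessian. A local solve with tolerance $\epsilon_i^\tau>0$ returns any $(\Delta\tilde{\bm\omega}_i,\Delta\tilde{\bm\zeta}_i)$ with $$\big\|\Gamma_i^\tau(\Delta\tilde{\bm\omega}_i;\Delta\tilde{\bm\zeta}_i)+\nabla\mathcal L^{(i),\tau}_{\rm QP}\big\|\le\epsilon_i^\tau\|\nabla\mathcal L^{(i),\tau}_{\rm QP}\|\quad\text{(local residual condition)};$$ local solvers are assumed to achieve this for any $\epsilon_i^\tau>0$ in finitely many iterations (almost surely if randomized). The composed direction $(\Delta\tilde{\bm z},\Delta\tilde{\bm\lambda})$ takes its stage-$k$ primal and dual components from local solution $i$ whenever $k\in\mathcal K_i$ (dual increments being the $\bm\zeta_k$). **Tests.** $\bm r=\Gamma^\tau(\Delta\tilde{\bm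 z};\Delta\tilde{\bm\lambda})+\nabla\mathcal L^\tau$, and $\bm r_i$ its restriction to $\mathcal K_i$. Accuracy condition: $\|\bm r\|\le\epsilon^\tau\|\nabla\mathcal L^\tau\|/(\|\Gamma^\tau\|\Psi^\tau)$ with $\Psi^\tau=\dfrac{20\max(\|\hat H^\tau\|^2,1)}{\min\{\gamma_{\rm RH},1\}\min\{\sigma_{\min}(G^\tau)^2,1\}}$. Descent condition: $(\nabla\mathcal L^\tau_{\bm\eta^\tau})^T(\Delta\tilde{\bm z};\Delta\tilde{\bm\lambda})\le-\eta_2^\tau\|\nabla\mathcal L^\tau\|^2/2$. Cap: $\epsilon^\tau_{\max}=\dfrac{(0.5-\beta)\eta_2^\tau}{(1+\eta_1^\tau+\eta_2^\tau)(\Psi^\tau\Upsilon^\tau)^2}$, $\Upsilon^\tau=\max\{\|G^\tau\|,\|\hat H^\tau\|,1\}$. **AOTD algorithm.** Inputs: $(\bm z^0,\bm\lambda^0)$, $\eta_1^0,\eta_2^0,\epsilon^0,\epsilon_i^0>0$, $b_i^0\in\mathbb Z_{\ge1}$, $\beta\in(0,0.5)$, $\delta\in(0,1)$, $\varrho_b,\varrho_\epsilon>0$, $\nu>1$, $\mu>0$, $\mathrm{tol}_{\rm KKT}\ge0$. For $\tau=0,1,2,\dots$: (i) if $\|\nabla\mathcal L^\tau\|\le\mathrm{tol}_{\rm KKT}$, return. (ii) If $\epsilon^\tau>\epsilon^\tau_{\max}$, set $\epsilon^\tau\gets\epsilon^\tau_{\max}/\nu$. Set the direction to $\bm0$. (iii)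 While the accuracy or the descent condition fails: [accuracy loop] while accuracy fails, perform all local solves with current $b_i^\tau,\epsilon_i^\tau$, compose, and, if accuracy still fails, update for all $i$ $$\epsilon_i^\tau\gets\epsilon_i^\tau\exp\!\Big(-\varrho_\epsilon\Big[\tfrac{\|\bm r_i\|}{\|\bm r\|}+\tfrac1{\sqrt M}\Big]\Big),\qquad b_i^\tau\gets b_i^\tau+\max\Big\{1,\Big\lceil\varrho_b\tfrac{\|\bm r_i\|}{\|\bm r\|}\Big\rceil\Big\};$$ then, if descent fails, set $\eta_1^\tau\gets\nu^2\eta_1^\tau$, $\eta_2^\tau\gets\eta_2^\tau/\nu$, recompute $\epsilon^\tau_{\max}$, and set $\epsilon^\tau\gets\min\{\epsilon^\tau_{\max},\epsilon^\tau/\nu^4\}$. (iv) Accept the direction as $(\Delta\tilde{\bm z}^\tau,\Delta\tilde{\bm\lambda}^\tau)$; backtrack $\alpha^\tau=1,\delta,\delta^2,\dots$ until the Armijo condition $\mathcal L_{\bm\eta^\tau}((\bm z^\tau;\bm\lambda^\tau)+\alpha^\tau(\Delta\tilde{\bm z}^\tau;\Delta\tilde{\bm\lambda}^\tau))\le\mathcal L^\tau_{\bm\eta^\tau}+\alpha^\tau\beta(\nabla\mathcal L^\tau_{\bm\eta^\tau})^T(\Delta\tilde{\bm z}^\tau;\Delta\tilde{\bm\lambda}^\tau)$ holds; set $(\bm z^{\tau+1};\bm\lambda^{\tau+1})=(\bm z^\tau;\bm\lambda^\tau)+\alpha^\tau(\Delta\tilde{\bm z}^\tau;\Delta\tilde{\bm\lambda}^\tau)$;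 carry $\eta_1^\tau,\eta_2^\tau,\epsilon^\tau,\epsilon_i^\tau,b_i^\tau$ to iteration $\tau+1$. Superscript-$\tau$ parameters without further comment are those in force when the step of iteration $\tau$ is accepted. **Assumptions** (constants independent of $\tau$). *Reduced-Hessian lower bound:* there is $\gamma_{\rm RH}>0$ (the constant used in $\Psi^\tau$) with $(Z^\tau)^T\hat H^\tau Z^\tau\succeq\gamma_{\rm RH}\mathbb I$ for all $\tau\ge0$, where the columns of $Z^\tau$ form an orthonormal basis of $\ker G^\tau$. *Uniform controllability:* there are $\gamma_C\in(0,1]$ and $t_C\in\{1,\dots,N\}$ such that for all $\tau\ge0$ and $0\le k\le N-t_C$ there is an integer $t=t_k^\tau\in[1,t_C]$ with $\Xi\Xi^T\succeq\gamma_C\mathbb I$, $\Xi=[B_{k+t-1},\ A_{k+t-1}B_{k+t-2},\ \dots,\ A_{k+t-1}\cdots A_{k+1}B_k]$ evaluated at $\bm z^\tau$. *Uniform boundedness:* there is $\Upsilon_{\rm Upper}\ge2$ with $\|\hat H_k^\tau\|,\|A_k^\tau\|,\|B_k^\tau\|\le\Upsilon_{\rm Upper}$ for $0\le k\le N-1$ and $\|\hat H_N^\tau\|\le\Upsilon_{\rm Upper}$, all $\tau\ge0$. *Compactness/smoothness:* there is a compact set $\mathcal Z\times\Lambda$, $\mathcal Z=\mathcal Z_0\times\dots\times\mathcal Z_N$, $\Lambda=\Lambda_0\times\dots\times\Lambda_N$, containing $(\bm z^\tau+\alpha\Delta\tilde{\bm z}^\tau,\bm\lambda^\tau+\alpha\Delta\tilde{\bm\lambda}^\tau)$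 for all $\tau\ge0$, $\alpha\in[0,1]$; $g_k,g_N,f_k$ are three times continuously differentiable; and for $0\le k\le N-1$, $\sup_{\mathcal Z_k\times\Lambda_{k+1}}\|H_k\|$, $\sup_{\mathcal Z_k}\|A_k\|$, $\sup_{\mathcal Z_k}\|B_k\|$, and $\sup_{\mathcal Z_N}\|H_N\|$ are all $\le\Upsilon_{\rm Upper}$ (same constant). *)

theory Defs
  imports "HOL-Analysis.Analysis"
begin

section \<open>Differential calculus and spectral quantities\<close>

definition grad :: "('a::euclidean_space \<Rightarrow> real) \<Rightarrow> 'a \<Rightarrow> 'a" where
  "grad F x = (THE D. GDERIV F x :> D)"

definition hess :: "('a::euclidean_space \<Rightarrow> real) \<Rightarrow> 'a \<Rightarrow> 'a \<Rightarrow> 'a" where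
  "hess F x = frechet_derivative (grad F) (at x)"

definition C3 :: "('a::euclidean_space \<Rightarrow> 'b::euclidean_space) \<Rightarrow> bool" where
  "C3 F \<longleftrightarrow> (\<exists>(F1 :: 'a \<Rightarrow> 'a \<Rightarrow>\<^sub>L 'b) (F2 :: 'a \<Rightarrow> 'a \<Rightarrow>\<^sub>L 'a \<Rightarrow>\<^sub>L 'b)
       (F3 :: 'a \<Rightarrow> 'a \<Rightarrow>\<^sub>L 'a \<Rightarrow>\<^sub>L 'a \<Rightarrow>\<^sub>L 'b).
     (\<forall>x. (F has_derivative blinfun_apply (F1 x)) (at x)) \<and>
     (\<forall>x. (F1 has_derivative blinfun_apply (F2 x)) (at x)) \<and>
     (\<forall>x. (F2 has_derivative blinfun_apply (F3 x)) (at x)) \<and>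
     continuous_on UNIV F3)"

abbreviation spec_norm :: "real^'c^'r \<Rightarrow> real" where
  "spec_norm A \<equiv> onorm ((*v) A)"

text \<open>Smallest singular value of a wide operator (at most as many rows as columns): the singular
  values are then the square roots of the eigenvalues of \<open>T T\<^sup>T\<close>.\<close>

definition sigma_min :: "('a::euclidean_space \<Rightarrow> 'b::euclidean_space) \<Rightarrow> real" where
  "sigma_min T = Min {sqrt c | c. \<exists>v. v \<noteq> 0 \<and> T (adjoint T v) = c *\<^sub>R v}"

text \<open>\<open>Z\<^sup>T H Z\<close> dominates \<open>\<gamma> I\<close> in the Loewner order, the columns of \<open>Z\<close> (the elements of \<open>B\<close>)
  being an orthonormal basis of the kernel of \<open>T\<close>; the entry of \<open>Z\<^sup>T H Z\<close> at \<open>(a, b)\<close> is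
  \<open>a \<bullet> H b\<close>.\<close>

definition reduced_hessian_bound ::
    "real \<Rightarrow> ('a::euclidean_space \<Rightarrow> 'a) \<Rightarrow> ('a \<Rightarrow> 'b::euclidean_space) \<Rightarrow> bool" where
  "reduced_hessian_bound \<gamma> H T \<longleftrightarrow>
     (\<exists>B. pairwise orthogonal B \<and> (\<forall>b\<in>B. norm b = 1) \<and> span B = {v. T v = 0} \<and>
        (\<forall>c :: 'a \<Rightarrow> real. (\<Sum>a\<in>B. \<Sum>b\<in>B. c a * c b * (a \<bullet> H b)) \<ge> \<gamma> * (\<Sum>b\<in>B. (c b)\<^sup>2)))"


section \<open>Trajectories\<close>

text \<open>The horizon is \<open>N = CARD('n)\<close>. Controls live on the stages \<open>0, \<dots>, N - 1\<close>, indexed by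
  \<open>'n\<close>; states and multipliers live on the stages \<open>0, \<dots>, N\<close>, indexed by \<open>'n option\<close>, which
  has \<open>N + 1\<close> elements. The library bijections \<open>from_nat_into UNIV\<close> and \<open>to_nat_on UNIV\<close>
  translate between stage numbers and indices. The norm and inner product of the product types
  below are the Euclidean ones of the stacked vectors.\<close>

type_synonym ('n, 'x, 'u) primal = "(real^'x^('n option)) \<times> (real^'u^'n)"
type_synonym ('n, 'x) dual = "real^'x^('n option)"
type_synonym ('n, 'x, 'u) pd = "('n, 'x, 'u) primal \<times> ('n, 'x) dual"

abbreviation stage_ix :: "nat \<Rightarrow> 'i::finite" where
  "stage_ix k \<equiv> from_nat_into UNIV k"

abbreviation stage_no :: "'i::finite \<Rightarrow> nat" where
  "stage_no s \<equiv> to_nat_on UNIV s"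

lemma stage_no_bij:
  "bij_betw (stage_no :: 'n::finite \<Rightarrow> nat) UNIV {..<CARD('n)}"
  "bij_betw (stage_no :: 'n option \<Rightarrow> nat) UNIV {..CARD('n)}"
  using to_nat_on_finite[of "UNIV :: 'n set"] to_nat_on_finite[of "UNIV :: 'n option set"]
  by (simp_all add: card_UNIV_option lessThan_Suc_atMost)

lemma stage_ix_stage_no: "stage_ix (stage_no s) = (s :: 'i::finite)"
  by (simp add: countable_finite)

definition xs :: "('n::finite, 'x::finite, 'u::finite) primal \<Rightarrow> nat \<Rightarrow> real^'x" where
  "xs z k = fst z $ stage_ix k"

definition us :: "('n::finite, 'x::finite, 'u::finite) primal \<Rightarrow> nat \<Rightarrow> real^'u" where
  "us z k = snd z $ stage_ix k"

definition ls :: "('n::finite, 'x::finite) dual \<Rightarrow> nat \<Rightarrow> real^'x" where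
  "ls l k = l $ stage_ix k"

definition embed :: "nat \<Rightarrow> (real^'x) \<times> (real^'u) \<Rightarrow> ('n::finite, 'x::finite, 'u::finite) primal" where
  "embed k v = ((\<chi> s. if stage_no s = k then fst v else 0), (\<chi> s. if stage_no s = k then snd v else 0))"

definition restrict_stages ::
    "nat set \<Rightarrow> ('n::finite, 'x::finite, 'u::finite) pd \<Rightarrow> ('n, 'x, 'u) pd" where
  "restrict_stages K w =
     (((\<chi> s. if stage_no s \<in> K then fst (fst w) $ s else 0),
       (\<chi> s. if stage_no s \<in> K then snd (fst w) $ s else 0)),
      (\<chi> s. if stage_no s \<in> K then snd w $ s else 0))"


section \<open>The nonlinear dynamic program\<close>

record ('x, 'u) ocp =
  stage_cost :: "nat \<Rightarrow> (real^'x) \<times> (real^'u) \<Rightarrow> real"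
  final_cost :: "real^'x \<Rightarrow> real"
  dyn :: "nat \<Rightarrow> (real^'x) \<times> (real^'u) \<Rightarrow> real^'x"
  init_state :: "real^'x"

definition total_cost ::
    "('x::finite, 'u::finite) ocp \<Rightarrow> ('n::finite, 'x, 'u) primal \<Rightarrow> real" where
  "total_cost P z = (\<Sum>k<CARD('n). stage_cost P k (xs z k, us z k)) + final_cost P (xs z CARD('n))"

definition constr ::
    "('x::finite, 'u::finite) ocp \<Rightarrow> ('n::finite, 'x, 'u) primal \<Rightarrow> ('n, 'x) dual" where
  "constr P z = (\<chi> s. case stage_no s of
       0 \<Rightarrow> xs z 0 - init_state P
     | Suc k \<Rightarrow> xs z (Suc k) - dyn P k (xs z k, us z k))"

definition lagr ::
    "('x::finite, 'u::finite) ocp \<Rightarrow> ('n::finite, 'x, 'u) pd \<Rightarrow> real" where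
  "lagr P w = total_cost P (fst w) + snd w \<bullet> constr P (fst w)"

text \<open>The first component of \<open>grad (lagr P) w\<close> is the gradient in \<open>z\<close>, the second one that in
  the multipliers.\<close>

definition merit ::
    "('x::finite, 'u::finite) ocp \<Rightarrow> real \<Rightarrow> real \<Rightarrow> ('n::finite, 'x, 'u) pd \<Rightarrow> real" where
  "merit P e1 e2 w = lagr P w + e1 / 2 * (norm (snd (grad (lagr P) w)))\<^sup>2
     + e2 / 2 * (norm (fst (grad (lagr P) w)))\<^sup>2"

definition Amat :: "('x::finite, 'u::finite) ocp \<Rightarrow> ('n::finite, 'x, 'u) primal \<Rightarrow> nat \<Rightarrow> real^'x^'x" where
  "Amat P z k = jacobian (\<lambda>x. dyn P k (x, us z k)) (at (xs z k))"

definition Bmat :: "('x::finite, 'u::finite) ocp \<Rightarrow> ('n::finite, 'x, 'u) primal \<Rightarrow> nat \<Rightarrow> real^'u^'x" where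
  "Bmat P z k = jacobian (\<lambda>u. dyn P k (xs z k, u)) (at (us z k))"

definition Gop ::
    "('x::finite, 'u::finite) ocp \<Rightarrow> ('n::finite, 'x, 'u) primal \<Rightarrow> ('n, 'x, 'u) primal \<Rightarrow> ('n, 'x) dual" where
  "Gop P z = frechet_derivative (constr P) (at z)"

definition Hop ::
    "('x::finite, 'u::finite) ocp \<Rightarrow> ('n::finite, 'x, 'u) pd \<Rightarrow> ('n, 'x, 'u) primal \<Rightarrow> ('n, 'x, 'u) primal" where
  "Hop P w = hess (\<lambda>z. lagr P (z, snd w)) (fst w)"

definition Hblock ::
    "('x::finite, 'u::finite) ocp \<Rightarrow> ('n::finite, 'x, 'u) pd \<Rightarrow> nat \<Rightarrow> (real^'x) \<times> (real^'u) \<Rightarrow> (real^'x) \<times> (real^'u)" where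
  "Hblock P w k v = (xs (Hop P w (embed k v)) k, us (Hop P w (embed k v)) k)"

definition Hblock_final ::
    "('x::finite, 'u::finite) ocp \<Rightarrow> ('n::finite, 'x, 'u) pd \<Rightarrow> real^'x \<Rightarrow> real^'x" where
  "Hblock_final P w p = xs (Hop P w (embed CARD('n) (p, 0))) CARD('n)"


section \<open>The modified Hessian and the KKT operator\<close>

record ('x, 'u) hess_mod =
  Qh :: "nat \<Rightarrow> real^'x^'x"
  Sh :: "nat \<Rightarrow> real^'x^'u"
  Rh :: "nat \<Rightarrow> real^'u^'u"

definition hm_block ::
    "('x::finite, 'u::finite) hess_mod \<Rightarrow> nat \<Rightarrow> (real^'x) \<times> (real^'u) \<Rightarrow> (real^'x) \<times> (real^'u)" where
  "hm_block H k v =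
     (Qh H k *v fst v + transpose (Sh H k) *v snd v, Sh H k *v fst v + Rh H k *v snd v)"

definition hm_op ::
    "('x::finite, 'u::finite) hess_mod \<Rightarrow> ('n::finite, 'x, 'u) primal \<Rightarrow> ('n, 'x, 'u) primal" where
  "hm_op H z =
     ((\<chi> s. let k = stage_no s in
          if k < CARD('n) then fst (hm_block H k (xs z k, us z k)) else Qh H k *v xs z k),
      (\<chi> s. let k = stage_no s in snd (hm_block H k (xs z k, us z k))))"

definition kkt_op ::
    "('x::finite, 'u::finite) ocp \<Rightarrow> ('x, 'u) hess_mod \<Rightarrow> ('n::finite, 'x, 'u) primal
      \<Rightarrow> ('n, 'x, 'u) pd \<Rightarrow> ('n, 'x, 'u) pd" where
  "kkt_op P H z d = (hm_op H (fst d) + adjoint (Gop P z) (snd d), Gop P z (fst d))"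


section \<open>Constants and state of the algorithm\<close>

record aotd_params =
  beta :: real
  delta :: real
  rho_b :: real
  rho_eps :: real
  nu :: real
  mu :: real
  tol_kkt :: real
  gamma_rh :: real
  num_sub :: nat
  knot :: "nat \<Rightarrow> nat"

record ('n, 'x, 'u) aotd_state =
  overlap :: "nat \<Rightarrow> nat"
  loc_tol :: "nat \<Rightarrow> real"
  eta1 :: real
  eta2 :: real
  tol :: real
  direction :: "('n, 'x, 'u) pd"

definition valid_params :: "nat \<Rightarrow> aotd_params \<Rightarrow> bool" where
  "valid_params N C \<longleftrightarrow>
     0 < beta C \<and> beta C < 1 / 2 \<and> 0 < delta C \<and> delta C < 1 \<and> 0 < rho_b C \<and> 0 < rho_eps C \<and>
     1 < nu C \<and> 0 < mu C \<and> 0 \<le> tol_kkt C \<and> 0 < gamma_rh C \<and>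
     1 \<le> num_sub C \<and> num_sub C \<le> N \<and> knot C 0 = 0 \<and> knot C (num_sub C) = N \<and>
     strict_mono_on {..num_sub C} (knot C)"

definition valid_start :: "aotd_params \<Rightarrow> ('n, 'x, 'u) aotd_state \<Rightarrow> bool" where
  "valid_start C s \<longleftrightarrow> 0 < eta1 s \<and> 0 < eta2 s \<and> 0 < tol s \<and>
     (\<forall>i<num_sub C. 0 < loc_tol s i \<and> 1 \<le> overlap s i)"

definition core :: "nat \<Rightarrow> aotd_params \<Rightarrow> nat \<Rightarrow> nat set" where
  "core N C i = (if i = num_sub C - 1 then {knot C i..N} else {knot C i..<knot C (Suc i)})"


section \<open>Local quadratic programs\<close>

text \<open>Local variables are stored in the type of full trajectories. The local Lagrangian only
  involves the components belonging to the window, so its gradient and its Hessian vanish on all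
  other ones, and the norm of a residual is the norm over the window. Truncated subtraction
  realizes \<open>max {n\<^sub>i - b\<^sub>i, 0}\<close>.\<close>

definition win_lo :: "aotd_params \<Rightarrow> nat \<Rightarrow> nat \<Rightarrow> nat" where
  "win_lo C b i = knot C i - b"

definition win_hi :: "nat \<Rightarrow> aotd_params \<Rightarrow> nat \<Rightarrow> nat \<Rightarrow> nat" where
  "win_hi N C b i = min (knot C (Suc i) + b) N"

definition qp_objective ::
    "('x::finite, 'u::finite) ocp \<Rightarrow> real \<Rightarrow> ('x, 'u) hess_mod \<Rightarrow> ('n::finite, 'x, 'u) pd
      \<Rightarrow> nat \<Rightarrow> nat \<Rightarrow> ('n, 'x, 'u) primal \<Rightarrow> real" where
  "qp_objective P m H w m1 m2 v =
     (let gz = fst (grad (lagr P) w);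
          HT = (if m2 < CARD('n) then Qh H m2 + mat m else Qh H m2)
      in (\<Sum>k=m1..<m2. 1 / 2 * ((xs v k, us v k) \<bullet> hm_block H k (xs v k, us v k))
            + xs gz k \<bullet> xs v k + us gz k \<bullet> us v k)
         + 1 / 2 * (xs v m2 \<bullet> (HT *v xs v m2)) + xs gz m2 \<bullet> xs v m2)"

definition qp_lagr ::
    "('x::finite, 'u::finite) ocp \<Rightarrow> real \<Rightarrow> ('x, 'u) hess_mod \<Rightarrow> ('n::finite, 'x, 'u) pd
      \<Rightarrow> nat \<Rightarrow> nat \<Rightarrow> ('n, 'x, 'u) pd \<Rightarrow> real" where
  "qp_lagr P m H w m1 m2 v =
     (let z = fst w; gl = snd (grad (lagr P) w); p = fst v; \<zeta> = snd v;
          d1 = (if m1 = 0 then init_state P - xs z 0 else 0)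
      in qp_objective P m H w m1 m2 p + ls \<zeta> m1 \<bullet> (xs p m1 - d1)
         + (\<Sum>k=m1..<m2. ls \<zeta> (Suc k) \<bullet>
              (xs p (Suc k) - Amat P z k *v xs p k - Bmat P z k *v us p k + ls gl (Suc k))))"

definition local_solution ::
    "('x::finite, 'u::finite) ocp \<Rightarrow> aotd_params \<Rightarrow> ('x, 'u) hess_mod \<Rightarrow> ('n::finite, 'x, 'u) pd
      \<Rightarrow> ('n, 'x, 'u) aotd_state \<Rightarrow> nat \<Rightarrow> ('n, 'x, 'u) pd \<Rightarrow> bool" where
  "local_solution P C H w s i v \<longleftrightarrow>
     (let l = qp_lagr P (mu C) H w (win_lo C (overlap s i) i) (win_hi CARD('n) C (overlap s i) i)
      in norm (hess l 0 v + grad l 0) \<le> loc_tol s i * norm (grad l 0))"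

definition composed ::
    "aotd_params \<Rightarrow> (nat \<Rightarrow> ('n::finite, 'x::finite, 'u::finite) pd) \<Rightarrow> ('n, 'x, 'u) pd \<Rightarrow> bool" where
  "composed C v d \<longleftrightarrow>
     (\<forall>i<num_sub C. \<forall>k\<in>core CARD('n) C i.
        xs (fst d) k = xs (fst (v i)) k \<and> ls (snd d) k = ls (snd (v i)) k \<and>
        (k < CARD('n) \<longrightarrow> us (fst d) k = us (fst (v i)) k))"


section \<open>Acceptance tests\<close>

definition Psi ::
    "('x::finite, 'u::finite) ocp \<Rightarrow> aotd_params \<Rightarrow> ('x, 'u) hess_mod \<Rightarrow> ('n::finite, 'x, 'u) pd \<Rightarrow> real" where
  "Psi P C H w =
     20 * max ((onorm (hm_op H :: ('n, 'x, 'u) primal \<Rightarrow> ('n, 'x, 'u) primal))\<^sup>2) 1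
       / (min (gamma_rh C) 1 * min ((sigma_min (Gop P (fst w)))\<^sup>2) 1)"

definition Upsilon ::
    "('x::finite, 'u::finite) ocp \<Rightarrow> ('x, 'u) hess_mod \<Rightarrow> ('n::finite, 'x, 'u) pd \<Rightarrow> real" where
  "Upsilon P H w =
     Max {onorm (Gop P (fst w)), onorm (hm_op H :: ('n, 'x, 'u) primal \<Rightarrow> ('n, 'x, 'u) primal), 1}"

definition residual ::
    "('x::finite, 'u::finite) ocp \<Rightarrow> ('x, 'u) hess_mod \<Rightarrow> ('n::finite, 'x, 'u) pd
      \<Rightarrow> ('n, 'x, 'u) aotd_state \<Rightarrow> ('n, 'x, 'u) pd" where
  "residual P H w s = kkt_op P H (fst w) (direction s) + grad (lagr P) w"

definition accurate ::
    "('x::finite, 'u::finite) ocp \<Rightarrow> aotd_params \<Rightarrow> ('x, 'u) hess_mod \<Rightarrow> ('n::finite, 'x, 'u) pd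
      \<Rightarrow> ('n, 'x, 'u) aotd_state \<Rightarrow> bool" where
  "accurate P C H w s \<longleftrightarrow>
     norm (residual P H w s)
       \<le> tol s * norm (grad (lagr P) w) / (onorm (kkt_op P H (fst w)) * Psi P C H w)"

definition descent ::
    "('x::finite, 'u::finite) ocp \<Rightarrow> ('n::finite, 'x, 'u) pd \<Rightarrow> ('n, 'x, 'u) aotd_state \<Rightarrow> bool" where
  "descent P w s \<longleftrightarrow>
     grad (merit P (eta1 s) (eta2 s)) w \<bullet> direction s
       \<le> - (eta2 s * (norm (grad (lagr P) w))\<^sup>2 / 2)"

definition eps_max ::
    "('x::finite, 'u::finite) ocp \<Rightarrow> aotd_params \<Rightarrow> ('x, 'u) hess_mod \<Rightarrow> ('n::finite, 'x, 'u) pd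
      \<Rightarrow> real \<Rightarrow> real \<Rightarrow> real" where
  "eps_max P C H w e1 e2 =
     (1 / 2 - beta C) * e2 / ((1 + e1 + e2) * (Psi P C H w * Upsilon P H w)\<^sup>2)"

definition armijo ::
    "('x::finite, 'u::finite) ocp \<Rightarrow> aotd_params \<Rightarrow> ('n::finite, 'x, 'u) pd
      \<Rightarrow> ('n, 'x, 'u) aotd_state \<Rightarrow> real \<Rightarrow> bool" where
  "armijo P C w s \<alpha> \<longleftrightarrow>
     merit P (eta1 s) (eta2 s) (w + \<alpha> *\<^sub>R direction s)
       \<le> merit P (eta1 s) (eta2 s) w
          + \<alpha> * beta C * (grad (merit P (eta1 s) (eta2 s)) w \<bullet> direction s)"


section \<open>The AOTD algorithm\<close>

definition refine ::
    "('x::finite, 'u::finite) ocp \<Rightarrow> aotd_params \<Rightarrow> ('x, 'u) hess_mod \<Rightarrow> ('n::finite, 'x, 'u) pd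
      \<Rightarrow> ('n, 'x, 'u) aotd_state \<Rightarrow> ('n, 'x, 'u) aotd_state" where
  "refine P C H w s =
     (let r = residual P H w s;
          ratio = (\<lambda>i. norm (restrict_stages (core CARD('n) C i) r) / norm r)
      in s\<lparr>loc_tol := (\<lambda>i. loc_tol s i * exp (- rho_eps C * (ratio i + 1 / sqrt (real (num_sub C))))),
           overlap := (\<lambda>i. overlap s i + max 1 (nat \<lceil>rho_b C * ratio i\<rceil>))\<rparr>)"

definition accuracy_step ::
    "('x::finite, 'u::finite) ocp \<Rightarrow> aotd_params \<Rightarrow> ('x, 'u) hess_mod \<Rightarrow> ('n::finite, 'x, 'u) pd
      \<Rightarrow> ('n, 'x, 'u) aotd_state \<Rightarrow> ('n, 'x, 'u) aotd_state \<Rightarrow> bool" where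
  "accuracy_step P C H w s s' \<longleftrightarrow>
     \<not> accurate P C H w s \<and>
     (\<exists>v d. (\<forall>i<num_sub C. local_solution P C H w s i (v i)) \<and> composed C v d \<and>
        s' = (let t = s\<lparr>direction := d\<rparr> in if accurate P C H w t then t else refine P C H w t))"

definition shrink ::
    "('x::finite, 'u::finite) ocp \<Rightarrow> aotd_params \<Rightarrow> ('x, 'u) hess_mod \<Rightarrow> ('n::finite, 'x, 'u) pd
      \<Rightarrow> ('n, 'x, 'u) aotd_state \<Rightarrow> ('n, 'x, 'u) aotd_state" where
  "shrink P C H w s =
     (let e1 = (nu C)\<^sup>2 * eta1 s; e2 = eta2 s / nu C
      in s\<lparr>eta1 := e1, eta2 := e2, tol := min (eps_max P C H w e1 e2) (tol s / nu C ^ 4)\<rparr>)"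

definition outer_step ::
    "('x::finite, 'u::finite) ocp \<Rightarrow> aotd_params \<Rightarrow> ('x, 'u) hess_mod \<Rightarrow> ('n::finite, 'x, 'u) pd
      \<Rightarrow> ('n, 'x, 'u) aotd_state \<Rightarrow> ('n, 'x, 'u) aotd_state \<Rightarrow> bool" where
  "outer_step P C H w s s' \<longleftrightarrow>
     \<not> (accurate P C H w s \<and> descent P w s) \<and>
     (\<exists>t. (accuracy_step P C H w)\<^sup>*\<^sup>* s t \<and> accurate P C H w t \<and>
        s' = (if descent P w t then t else shrink P C H w t))"

definition prepare ::
    "('x::finite, 'u::finite) ocp \<Rightarrow> aotd_params \<Rightarrow> ('x, 'u) hess_mod \<Rightarrow> ('n::finite, 'x, 'u) pd
      \<Rightarrow> ('n, 'x, 'u) aotd_state \<Rightarrow> ('n, 'x, 'u) aotd_state" where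
  "prepare P C H w s =
     (let e = eps_max P C H w (eta1 s) (eta2 s)
      in s\<lparr>tol := (if tol s > e then e / nu C else tol s), direction := 0\<rparr>)"

text \<open>From the carried parameters \<open>s\<close>, one iteration accepts \<open>s'\<close>, which contains the direction
  and the parameters in force at the line search.\<close>

definition accepts ::
    "('x::finite, 'u::finite) ocp \<Rightarrow> aotd_params \<Rightarrow> ('x, 'u) hess_mod \<Rightarrow> ('n::finite, 'x, 'u) pd
      \<Rightarrow> ('n, 'x, 'u) aotd_state \<Rightarrow> ('n, 'x, 'u) aotd_state \<Rightarrow> bool" where
  "accepts P C H w s s' \<longleftrightarrow>
     norm (grad (lagr P) w) > tol_kkt C \<and>
     (outer_step P C H w)\<^sup>*\<^sup>* (prepare P C H w s) s' \<and> accurate P C H w s' \<and> descent P w s'"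

text \<open>A run that accepts a direction in the iterations \<open>\<tau> < T\<close>, with \<open>T = \<infinity>\<close> for an infinite
  sequence of iterates. The line search is known to have succeeded only in those iterations that
  are followed by another one, so a finite run may be stuck in its last line search.\<close>

definition aotd_run ::
    "('x::finite, 'u::finite) ocp \<Rightarrow> aotd_params \<Rightarrow> (nat \<Rightarrow> ('x, 'u) hess_mod)
      \<Rightarrow> ('n::finite, 'x, 'u) aotd_state \<Rightarrow> (nat \<Rightarrow> ('n, 'x, 'u) pd)
      \<Rightarrow> (nat \<Rightarrow> ('n, 'x, 'u) aotd_state) \<Rightarrow> enat \<Rightarrow> bool" where
  "aotd_run P C H s0 w s T \<longleftrightarrow>
     (\<forall>\<tau>. enat \<tau> < T \<longrightarrow>
        accepts P C (H \<tau>) (w \<tau>) (case \<tau> of 0 \<Rightarrow> s0 | Suc \<tau>' \<Rightarrow> s \<tau>') (s \<tau>)) \<and>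
     (\<forall>\<tau>. enat (Suc \<tau>) < T \<longrightarrow>
        (\<exists>j. armijo P C (w \<tau>) (s \<tau>) (delta C ^ j) \<and>
             (\<forall>i<j. \<not> armijo P C (w \<tau>) (s \<tau>) (delta C ^ i)) \<and>
             w (Suc \<tau>) = w \<tau> + (delta C ^ j) *\<^sub>R direction (s \<tau>)))"


section \<open>Assumptions\<close>

definition hessian_modification ::
    "('x::finite, 'u::finite) ocp \<Rightarrow> real \<Rightarrow> ('x, 'u) hess_mod \<Rightarrow> ('n::finite, 'x, 'u) pd \<Rightarrow> bool" where
  "hessian_modification P \<gamma> H w \<longleftrightarrow>
     (\<forall>k\<le>CARD('n). transpose (Qh H k) = Qh H k) \<and> (\<forall>k<CARD('n). transpose (Rh H k) = Rh H k) \<and>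
     (reduced_hessian_bound \<gamma> (Hop P w) (Gop P (fst w)) \<longrightarrow> hm_op H = Hop P w)"

text \<open>\<open>trans_mat P z a j = A\<^bsub>a + j - 1\<^esub> \<cdots> A\<^bsub>a\<^esub>\<close>\<close>

primrec trans_mat ::
    "('x::finite, 'u::finite) ocp \<Rightarrow> ('n::finite, 'x, 'u) primal \<Rightarrow> nat \<Rightarrow> nat \<Rightarrow> real^'x^'x" where
  "trans_mat P z a 0 = mat 1"
| "trans_mat P z a (Suc j) = Amat P z (a + j) ** trans_mat P z a j"

text \<open>The block of \<open>\<Xi>\<close> belonging to \<open>B\<^sub>j\<close>, \<open>k \<le> j < k + t\<close>, is \<open>A\<^bsub>k + t - 1\<^esub> \<cdots> A\<^bsub>j + 1\<^esub> B\<^sub>j\<close>, and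
  \<open>\<Xi> \<Xi>\<^sup>T\<close> is the sum over the blocks \<open>X\<close> of \<open>X X\<^sup>T\<close>.\<close>

definition ctrl_gram ::
    "('x::finite, 'u::finite) ocp \<Rightarrow> ('n::finite, 'x, 'u) primal \<Rightarrow> nat \<Rightarrow> nat \<Rightarrow> real^'x^'x" where
  "ctrl_gram P z k t =
     (\<Sum>j=k..<k + t. let X = trans_mat P z (Suc j) (k + t - Suc j) ** Bmat P z j
                    in X ** transpose X)"

definition controllable ::
    "('x::finite, 'u::finite) ocp \<Rightarrow> real \<Rightarrow> nat \<Rightarrow> ('n::finite, 'x, 'u) primal \<Rightarrow> bool" where
  "controllable P \<gamma> tc z \<longleftrightarrow>
     (\<forall>k. k + tc \<le> CARD('n) \<longrightarrow>
        (\<exists>t\<in>{1..tc}. \<forall>v. v \<bullet> (ctrl_gram P z k t *v v) \<ge> \<gamma> * (v \<bullet> v)))"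

definition bounded_data ::
    "('x::finite, 'u::finite) ocp \<Rightarrow> real \<Rightarrow> ('x, 'u) hess_mod \<Rightarrow> ('n::finite, 'x, 'u) primal \<Rightarrow> bool" where
  "bounded_data P U H z \<longleftrightarrow>
     (\<forall>k<CARD('n). onorm (hm_block H k) \<le> U \<and> spec_norm (Amat P z k) \<le> U \<and> spec_norm (Bmat P z k) \<le> U) \<and>
     spec_norm (Qh H CARD('n)) \<le> U"

definition C3_problem :: "nat \<Rightarrow> ('x::finite, 'u::finite) ocp \<Rightarrow> bool" where
  "C3_problem N P \<longleftrightarrow>
     (\<forall>k<N. C3 (stage_cost P k) \<and> C3 (dyn P k)) \<and> C3 (final_cost P)"

definition stage_product ::
    "(nat \<Rightarrow> ((real^'x) \<times> (real^'u)) set) \<Rightarrow> (real^'x) set \<Rightarrow> (nat \<Rightarrow> (real^'x) set)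
      \<Rightarrow> ('n::finite, 'x::finite, 'u::finite) pd set" where
  "stage_product Zs ZN Ls = {w. (\<forall>k<CARD('n). (xs (fst w) k, us (fst w) k) \<in> Zs k) \<and>
     xs (fst w) CARD('n) \<in> ZN \<and> (\<forall>k\<le>CARD('n). ls (snd w) k \<in> Ls k)}"

text \<open>The blocks of the Hessian and the Jacobians at a point of the product set depend on
  \<open>(z\<^sub>k, \<lambda>\<^bsub>k + 1\<^esub>)\<close> and \<open>z\<^sub>k\<close> only, so bounding them on the product set, which contains an
  iterate if \<open>T > 0\<close>, is the same as bounding them on its factors.\<close>

definition compact_region ::
    "('x::finite, 'u::finite) ocp \<Rightarrow> real \<Rightarrow> (nat \<Rightarrow> ('n::finite, 'x, 'u) pd)
      \<Rightarrow> (nat \<Rightarrow> ('n, 'x, 'u) aotd_state) \<Rightarrow> enat \<Rightarrow> bool" where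
  "compact_region P U w s T \<longleftrightarrow>
     (\<exists>Zs ZN Ls. let K = (stage_product Zs ZN Ls :: ('n, 'x, 'u) pd set) in
        compact K \<and>
        (\<forall>\<tau>. enat \<tau> < T \<longrightarrow> (\<forall>\<alpha>\<in>{0..1}. w \<tau> + \<alpha> *\<^sub>R direction (s \<tau>) \<in> K)) \<and>
        (\<forall>y\<in>K. (\<forall>k<CARD('n). onorm (Hblock P y k) \<le> U \<and> spec_norm (Amat P (fst y) k) \<le> U \<and>
                    spec_norm (Bmat P (fst y) k) \<le> U) \<and>
                onorm (Hblock_final P y) \<le> U))"

end

(*
  The accuracy test ties the residual of the KKT system to eps_max, so an accepted direction can be
  analysed without knowing how the local solvers produced it. Split the primal part of the direction
  into a vector of ker G, on which the modified Hessian is coercive, and a preimage of G p of size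
  O(|G p|). Young's inequality then shows that accuracy implies descent as soon as eta2 is small and
  eta1 * eta2 is large. One penalty update divides eta2 by nu and multiplies eta1 * eta2 by nu, and the
  thresholds are uniform on the compact region, so there are finitely many updates in the whole run and
  the merit function is eventually fixed. On the compact region its gradient is uniformly continuous
  and the directions are bounded: backtracking steps stay away from 0 as long as the KKT residual does,
  and since the merit function decreases and is bounded below, the residual tends to 0.
*)

theory Submission
  imports Defs
begin

text \<open>The obstacle is the multiplier step, in which nothing is coercive. It is recovered from
  the first block row of the KKT system, which bounds it by the primal gradient, the tangential step
  and the infeasibility; this works because \<open>Gop\<close> is surjective and its adjoint is
  bounded below uniformly on the compact region. The price is a mixed term, primal gradient times
  infeasibility, with no small factor. The merit function offers only \<open>eta2\<close> times the
  square of the one and \<open>eta1\<close> times the square of the other, so absorbing it forces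
  \<open>eta1 * eta2\<close> to be large. Smallness of \<open>eta2\<close> has another cause: the
  merit gradient contains the true Hessian, the linear system the modified one, and their difference
  couples the primal gradient with the tangential step, whose square has the fixed weight
  \<open>gamma_rh\<close>. Finally, inexactness costs \<open>eta1\<close> times infeasibility times
  residual; the factor \<open>1 + e1 + e2\<close> in the denominator of \<open>eps_max\<close> keeps
  this below a small multiple of \<open>eta2\<close> times the squared KKT residual.
  \<open>Psi\<close>, \<open>Upsilon\<close> and the norm of the KKT operator contribute the lower
  bounds 20, 1 and 1, and with them the constants 800 and 16000.\<close>

section \<open>Continuously differentiable functions\<close>

text \<open>The derivative is required to be continuous, respectively \<open>C1\<close>, in every fixed direction
  only. In finite dimension this is the usual notion, and no operator-valued functions are needed.\<close>

definition C1 :: "('a::euclidean_space \<Rightarrow> 'b::real_normed_vector) \<Rightarrow> bool" where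
  "C1 F \<longleftrightarrow> (\<exists>D. (\<forall>x. (F has_derivative D x) (at x)) \<and> (\<forall>v. continuous_on UNIV (\<lambda>x. D x v)))"

definition C2 :: "('a::euclidean_space \<Rightarrow> 'b::real_normed_vector) \<Rightarrow> bool" where
  "C2 F \<longleftrightarrow> (\<exists>D. (\<forall>x. (F has_derivative D x) (at x)) \<and> (\<forall>v. C1 (\<lambda>x. D x v)))"

lemma C1_continuous_on:
  assumes "C1 F"
  shows "continuous_on S F"
  using assms unfolding C1_def
  by (meson continuous_at_imp_continuous_on has_derivative_continuous)

lemma C1_frechet_derivative:
  assumes "C1 F"
  shows "(F has_derivative frechet_derivative F (at x)) (at x)"
    and "continuous_on S (\<lambda>x. frechet_derivative F (at x) v)"
proof -
  obtain D where D: "\<And>x. (F has_derivative D x) (at x)" "\<And>v. continuous_on UNIV (\<lambda>x. D x v)"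
    using assms unfolding C1_def by blast
  have eq: "frechet_derivative F (at x) = D x" for x
    using D(1) frechet_derivative_at by metis
  show "(F has_derivative frechet_derivative F (at x)) (at x)"
    using D(1) eq by simp
  show "continuous_on S (\<lambda>x. frechet_derivative F (at x) v)"
    unfolding eq using D(2) continuous_on_subset by blast
qed

lemma C1_bounded_linear_comp:
  assumes "C1 F" "bounded_linear L" "bounded_linear M"
  shows "C1 (\<lambda>x. L (F (M x)))"
proof -
  obtain D where D: "\<And>x. (F has_derivative D x) (at x)" "\<And>v. continuous_on UNIV (\<lambda>x. D x v)"
    using assms unfolding C1_def by blast
  have 1: "((\<lambda>x. L (F (M x))) has_derivative (\<lambda>v. L (D (M x) (M v)))) (at x)" for x
    using bounded_linear.has_derivative[OF assms(2) has_derivative_compose[OF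
      bounded_linear_imp_has_derivative[OF assms(3)] D(1)]] .
  have 2: "continuous_on UNIV (\<lambda>x. L (D (M x) (M v)))" for v
    using bounded_linear.continuous_on[OF assms(2)]
      continuous_on_compose2[OF D(2) linear_continuous_on[OF assms(3)]] by blast
  show ?thesis
    unfolding C1_def using 1 2 by (intro exI[of _ "\<lambda>x v. L (D (M x) (M v))"]) blast
qed

lemma C1_bounded_bilinear:
  assumes B: "bounded_bilinear B" and "C1 F" "C1 G"
  shows "C1 (\<lambda>x. B (F x) (G x))"
proof -
  obtain D where D: "\<And>x. (F has_derivative D x) (at x)" "\<And>v. continuous_on UNIV (\<lambda>x. D x v)"
    using assms unfolding C1_def by blast
  obtain E where E: "\<And>x. (G has_derivative E x) (at x)" "\<And>v. continuous_on UNIV (\<lambda>x. E x v)"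
    using assms unfolding C1_def by blast
  have "((\<lambda>x. B (F x) (G x)) has_derivative (\<lambda>v. B (F x) (E x v) + B (D x v) (G x))) (at x)" for x
    using bounded_bilinear.FDERIV[OF B D(1) E(1)] .
  moreover have "continuous_on UNIV (\<lambda>x. B (F x) (E x v) + B (D x v) (G x))" for v
    by (intro continuous_on_add bounded_bilinear.continuous_on[OF B] D E
      C1_continuous_on[OF assms(2)] C1_continuous_on[OF assms(3)])
  ultimately show ?thesis
    unfolding C1_def by (intro exI[of _ "\<lambda>x v. B (F x) (E x v) + B (D x v) (G x)"]) blast
qed

lemma C1_add:
  assumes "C1 F" "C1 G"
  shows "C1 (\<lambda>x. F x + G x)"
proof -
  obtain D where D: "\<And>x. (F has_derivative D x) (at x)" "\<And>v. continuous_on UNIV (\<lambda>x. D x v)"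
    using assms unfolding C1_def by blast
  obtain E where E: "\<And>x. (G has_derivative E x) (at x)" "\<And>v. continuous_on UNIV (\<lambda>x. E x v)"
    using assms unfolding C1_def by blast
  show ?thesis
    unfolding C1_def
    by (intro exI[of _ "\<lambda>x v. D x v + E x v"] conjI allI has_derivative_add continuous_on_add D E)
qed

lemma C1_const: "C1 (\<lambda>x. c)"
  unfolding C1_def by (intro exI[of _ "\<lambda>x v. 0"]) auto

lemma C1_bounded_linear:
  assumes "bounded_linear L"
  shows "C1 L"
  unfolding C1_def using assms bounded_linear_imp_has_derivative
  by (intro exI[of _ "\<lambda>x. L"]) auto

lemma C1_sum:
  assumes "\<And>i. i \<in> I \<Longrightarrow> C1 (F i)"
  shows "C1 (\<lambda>x. \<Sum>i\<in>I. F i x)"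
  using assms by (induction I rule: infinite_finite_induct) (auto intro: C1_const C1_add)

lemma C2_imp_C1:
  assumes "C2 F"
  shows "C1 F"
  using assms C1_continuous_on unfolding C2_def C1_def[of F] by metis

lemma C1_frechet_derivative_of_C2:
  assumes "C2 F"
  shows "C1 (\<lambda>z. frechet_derivative F (at z) v)"
proof -
  obtain D where D: "\<And>x. (F has_derivative D x) (at x)" "\<And>v. C1 (\<lambda>x. D x v)"
    using assms unfolding C2_def by blast
  then have "frechet_derivative F (at x) = D x" for x
    using frechet_derivative_at by metis
  then show ?thesis using D(2) by simp
qed

lemma C2_bounded_linear_comp:
  assumes "C2 F" "bounded_linear L" "bounded_linear M"
  shows "C2 (\<lambda>x. L (F (M x)))"
proof -
  obtain D where D: "\<And>x. (F has_derivative D x) (at x)" "\<And>v. C1 (\<lambda>x. D x v)"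
    using assms unfolding C2_def by blast
  have 1: "((\<lambda>x. L (F (M x))) has_derivative (\<lambda>v. L (D (M x) (M v)))) (at x)" for x
    using bounded_linear.has_derivative[OF assms(2) has_derivative_compose[OF
      bounded_linear_imp_has_derivative[OF assms(3)] D(1)]] .
  show ?thesis
    unfolding C2_def using 1 C1_bounded_linear_comp[OF D(2) assms(2,3)]
    by (intro exI[of _ "\<lambda>x v. L (D (M x) (M v))"]) blast
qed

lemma C2_add:
  assumes "C2 F" "C2 G"
  shows "C2 (\<lambda>x. F x + G x)"
proof -
  obtain D where D: "\<And>x. (F has_derivative D x) (at x)" "\<And>v. C1 (\<lambda>x. D x v)"
    using assms unfolding C2_def by blast
  obtain E where E: "\<And>x. (G has_derivative E x) (at x)" "\<And>v. C1 (\<lambda>x. E x v)"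
    using assms unfolding C2_def by blast
  show ?thesis
    unfolding C2_def
    by (intro exI[of _ "\<lambda>x v. D x v + E x v"] conjI allI has_derivative_add C1_add D E)
qed

lemma C2_const: "C2 (\<lambda>x. c)"
  unfolding C2_def by (intro exI[of _ "\<lambda>x v. 0"]) (auto intro: C1_const)

lemma C2_bounded_linear:
  assumes "bounded_linear L"
  shows "C2 L"
  unfolding C2_def using assms bounded_linear_imp_has_derivative C1_const
  by (intro exI[of _ "\<lambda>x. L"]) auto

lemma C2_sum:
  assumes "\<And>i. i \<in> I \<Longrightarrow> C2 (F i)"
  shows "C2 (\<lambda>x. \<Sum>i\<in>I. F i x)"
  using assms by (induction I rule: infinite_finite_induct) (auto intro: C2_const C2_add)

lemma bounded_linear_axis: "bounded_linear (axis i :: 'b::euclidean_space \<Rightarrow> 'b^'n)"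
  by (intro linear_conv_bounded_linear[THEN iffD1] linearI) (auto simp: axis_def vec_eq_iff)

text \<open>A vector is the sum of its entries placed by the linear maps \<open>axis i\<close>,
  which reduces the claim to finite sums and linear compositions.\<close>

lemma C2_vec_lambda:
  fixes F :: "'a::euclidean_space \<Rightarrow> 'n::finite \<Rightarrow> 'b::euclidean_space"
  assumes "\<And>i. C2 (\<lambda>x. F x i)"
  shows "C2 (\<lambda>x. \<chi> i. F x i)"
proof -
  have "(\<chi> i. F x i) = (\<Sum>i\<in>UNIV. axis i (F x i))" for x
    by (simp add: vec_eq_iff axis_def sum_component if_distrib[of "\<lambda>v. v $ _"] cong: if_cong)
  moreover have "C2 (\<lambda>x. \<Sum>i\<in>UNIV. axis i (F x i))"
    using C2_bounded_linear_comp[OF assms bounded_linear_axis bounded_linear_ident]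
    by (intro C2_sum)
  ultimately show ?thesis by simp
qed

text \<open>Evaluation at a fixed vector is linear in the operator, so derivatives of
  operator-valued maps become derivatives in fixed directions; \<open>F2\<close> is continuous
  because it is differentiable.\<close>

lemma C3_imp_C2:
  assumes "C3 F"
  shows "C2 F"
proof -
  obtain F1 F2 F3 where F: "\<And>x. (F has_derivative blinfun_apply (F1 x)) (at x)"
     "\<And>x. (F1 has_derivative blinfun_apply (F2 x)) (at x)"
     "\<And>x. (F2 has_derivative blinfun_apply (F3 x)) (at x)"
    using assms unfolding C3_def by blast
  have "((\<lambda>x. F1 x v) has_derivative (\<lambda>h. F2 x h v)) (at x)" for x v
    using bounded_linear.has_derivative[OF bounded_linear_blinfun_apply[OF bounded_linear_ident] F(2)]
    using bounded_bilinear.FDERIV[OF bounded_bilinear_blinfun_apply F(2) has_derivative_const[of v]]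
    by (simp add: blinfun.zero_right)
  moreover have "continuous_on UNIV F2"
    using F(3) by (meson continuous_at_imp_continuous_on has_derivative_continuous)
  then have "continuous_on UNIV (\<lambda>x. F2 x h v)" for h v
    by (intro continuous_intros)
  ultimately have "C1 (\<lambda>x. F1 x v)" for v
    unfolding C1_def by (intro exI[of _ "\<lambda>x h. F2 x h v"]) blast
  then show ?thesis
    unfolding C2_def using F(1) by (intro exI[of _ "\<lambda>x. blinfun_apply (F1 x)"]) blast
qed

section \<open>Gradients, and operator bounds from compactness\<close>

lemma grad_eqI:
  fixes F :: "'a::euclidean_space \<Rightarrow> real"
  assumes "(F has_derivative (\<lambda>h. h \<bullet> D)) (at x)"
  shows "grad F x = D"
  unfolding grad_def
proof (rule the_equality)
  show "GDERIV F x :> D" using assms by (simp add: gderiv_def)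
  fix E assume "GDERIV F x :> E"
  then have "(\<lambda>h. h \<bullet> E) = (\<lambda>h. h \<bullet> D)"
    using assms has_derivative_unique by (auto simp: gderiv_def)
  then show "E = D" by (metis vector_eq_ldot)
qed

text \<open>Riesz representation: the gradient has the values of \<open>D\<close> on the standard
  basis as its coordinates.\<close>

lemma grad_inner:
  fixes F :: "'a::euclidean_space \<Rightarrow> real"
  assumes "(F has_derivative D) (at x)"
  shows "grad F x \<bullet> v = D v"
proof -
  have lin: "linear D" using assms has_derivative_linear by blast
  have D: "D = (\<lambda>h. h \<bullet> (\<Sum>b\<in>Basis. D b *\<^sub>R b))"
  proof
    fix h
    have "D h = D (\<Sum>b\<in>Basis. (h \<bullet> b) *\<^sub>R b)" by (simp add: euclidean_representation)
    also have "\<dots> = (\<Sum>b\<in>Basis. (h \<bullet> b) * D b)"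
      by (simp add: linear_sum[OF lin] linear_scale[OF lin])
    finally show "D h = h \<bullet> (\<Sum>b\<in>Basis. D b *\<^sub>R b)"
      by (simp add: inner_sum_right mult.commute)
  qed
  have "grad F x = (\<Sum>b\<in>Basis. D b *\<^sub>R b)"
    using assms D by (intro grad_eqI) metis
  then show ?thesis using D by (metis inner_commute)
qed

text \<open>Continuity in each fixed direction bounds \<open>D\<close> on every basis vector; finite
  dimension combines these bounds into one for the operator.\<close>

lemma compact_linear_bound:
  fixes D :: "'a::topological_space \<Rightarrow> 'b::euclidean_space \<Rightarrow> 'c::real_normed_vector"
  assumes "compact K" "\<And>x. x \<in> K \<Longrightarrow> linear (D x)" "\<And>v. continuous_on K (\<lambda>x. D x v)"
  obtains B where "0 \<le> B" "\<And>x v. x \<in> K \<Longrightarrow> norm (D x v) \<le> B * norm v"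
proof -
  have "\<exists>B. \<forall>x\<in>K. norm (D x b) \<le> B" for b
    using compact_imp_bounded[OF compact_continuous_image[OF assms(3) assms(1)]]
    by (auto simp: bounded_iff)
  then obtain B where B: "\<And>b x. x \<in> K \<Longrightarrow> norm (D x b) \<le> B b" by metis
  \<comment> \<open>The absolute values keep the constant nonnegative even if \<open>K\<close> is
    empty and the \<open>B b\<close> are arbitrary.\<close>
  have "norm (D x v) \<le> (\<Sum>b\<in>Basis. \<bar>B b\<bar>) * norm v" if x: "x \<in> K" for x v
  proof -
    have "norm (D x v) = norm (D x (\<Sum>b\<in>Basis. (v \<bullet> b) *\<^sub>R b))" by (simp add: euclidean_representation)
    also have "\<dots> = norm (\<Sum>b\<in>Basis. (v \<bullet> b) *\<^sub>R D x b)"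
      by (simp add: linear_sum[OF assms(2)[OF x]] linear_scale[OF assms(2)[OF x]])
    also have "\<dots> \<le> (\<Sum>b\<in>Basis. \<bar>v \<bullet> b\<bar> * norm (D x b))"
      by (rule order_trans[OF norm_sum]) simp
    also have "\<dots> \<le> (\<Sum>b\<in>Basis. norm v * \<bar>B b\<bar>)"
    proof (rule sum_mono)
      fix b :: 'b assume b: "b \<in> Basis"
      have "norm (D x b) \<le> \<bar>B b\<bar>" using B[OF x, of b] by linarith
      then show "\<bar>v \<bullet> b\<bar> * norm (D x b) \<le> norm v * \<bar>B b\<bar>"
        using Basis_le_norm[OF b, of v] by (intro mult_mono) auto
    qed
    finally show ?thesis by (simp add: sum_distrib_left mult.commute)
  qed
  then show thesis by (intro that[of "\<Sum>b\<in>Basis. \<bar>B b\<bar>"]) (auto intro: sum_nonneg)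
qed

section \<open>Equality constrained problems\<close>

text \<open>Smoothness of the merit function is studied for the abstract problem of minimizing
  \<open>g\<close> subject to \<open>f = 0\<close>, of which the staged program is an instance. The
  merit function contains first derivatives, so \<open>C2\<close> data make it
  \<open>C1\<close>.\<close>

locale nlp =
  fixes g :: "'a::euclidean_space \<Rightarrow> real" and f :: "'a \<Rightarrow> 'b::euclidean_space"
  assumes C2_g: "C2 g" and C2_f: "C2 f"
begin

abbreviation "Dg z \<equiv> frechet_derivative g (at z)"
abbreviation "Df z \<equiv> frechet_derivative f (at z)"

definition lagrangian :: "'a \<times> 'b \<Rightarrow> real" where
  "lagrangian w = g (fst w) + snd w \<bullet> f (fst w)"

text \<open>The Riesz vector of the derivative of \<open>lagrangian\<close> in the primal variable,
  written in a basis so that its differentiability follows from that of its coefficients.\<close>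

definition grad_primal :: "'a \<times> 'b \<Rightarrow> 'a" where
  "grad_primal w = (\<Sum>b\<in>Basis. (Dg (fst w) b + snd w \<bullet> Df (fst w) b) *\<^sub>R b)"

abbreviation "Dgrad_primal w \<equiv> frechet_derivative grad_primal (at w)"

definition augmented :: "real \<Rightarrow> real \<Rightarrow> 'a \<times> 'b \<Rightarrow> real" where
  "augmented e1 e2 w = lagrangian w + e1 / 2 * (norm (f (fst w)))\<^sup>2 + e2 / 2 * (norm (grad_primal w))\<^sup>2"

definition Daugmented :: "real \<Rightarrow> real \<Rightarrow> 'a \<times> 'b \<Rightarrow> 'a \<times> 'b \<Rightarrow> real" where
  "Daugmented e1 e2 w v = grad_primal w \<bullet> fst v + f (fst w) \<bullet> snd v + e1 * (f (fst w) \<bullet> Df (fst w) (fst v))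
     + e2 * (grad_primal w \<bullet> Dgrad_primal w v)"

lemma has_derivative_g: "(g has_derivative Dg z) (at z)"
  and has_derivative_f: "(f has_derivative Df z) (at z)"
  using C1_frechet_derivative(1) C2_imp_C1 C2_g C2_f by blast+

lemma linear_Dg: "linear (Dg z)" and linear_Df: "linear (Df z)"
  using has_derivative_g has_derivative_f has_derivative_linear by blast+

lemma continuous_on_Df: "continuous_on S (\<lambda>z. Df z v)"
  using C1_continuous_on C1_frechet_derivative_of_C2 C2_f by blast

lemma inner_grad_primal: "h \<bullet> grad_primal w = Dg (fst w) h + snd w \<bullet> Df (fst w) h"
proof -
  have l: "linear (\<lambda>h. Dg (fst w) h + snd w \<bullet> Df (fst w) h)"
    using linear_Dg[of "fst w"] linear_Df[of "fst w"]
    by (intro linearI) (auto simp: linear_add linear_scale inner_add_right algebra_simps)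
  have "Dg (fst w) h + snd w \<bullet> Df (fst w) h =
    Dg (fst w) (\<Sum>b\<in>Basis. (h \<bullet> b) *\<^sub>R b) + snd w \<bullet> Df (fst w) (\<Sum>b\<in>Basis. (h \<bullet> b) *\<^sub>R b)"
    by (simp add: euclidean_representation)
  also have "\<dots> = (\<Sum>b\<in>Basis. (h \<bullet> b) *\<^sub>R (Dg (fst w) b + snd w \<bullet> Df (fst w) b))"
    using linear_sum[OF l, of "\<lambda>b. (h \<bullet> b) *\<^sub>R b" Basis] linear_scale[OF l] by simp
  also have "\<dots> = h \<bullet> grad_primal w"
    by (simp add: grad_primal_def inner_sum_right mult.commute)
  finally show ?thesis by simp
qed

lemma has_derivative_lagrangian:
  "(lagrangian has_derivative (\<lambda>v. v \<bullet> (grad_primal w, f (fst w)))) (at w)"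
proof -
  have 1: "((\<lambda>w. g (fst w)) has_derivative (\<lambda>v. Dg (fst w) (fst v))) (at w)"
    by (rule has_derivative_compose[OF bounded_linear_imp_has_derivative[OF bounded_linear_fst]
      has_derivative_g])
  have 2: "((\<lambda>w. f (fst w)) has_derivative (\<lambda>v. Df (fst w) (fst v))) (at w)"
    by (rule has_derivative_compose[OF bounded_linear_imp_has_derivative[OF bounded_linear_fst]
      has_derivative_f])
  have "(lagrangian has_derivative (\<lambda>v. Dg (fst w) (fst v) +
     (snd w \<bullet> Df (fst w) (fst v) + snd v \<bullet> f (fst w)))) (at w)"
    unfolding lagrangian_def[abs_def]
    by (intro has_derivative_add 1 has_derivative_inner 2 bounded_linear_imp_has_derivative
       bounded_linear_snd)
  also have "(\<lambda>v. Dg (fst w) (fst v) + (snd w \<bullet> Df (fst w) (fst v) + snd v \<bullet> f (fst w)))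
     = (\<lambda>v. v \<bullet> (grad_primal w, f (fst w)))"
    by (auto simp: fun_eq_iff inner_prod_def inner_grad_primal)
  finally show ?thesis .
qed

lemma grad_lagrangian: "grad lagrangian w = (grad_primal w, f (fst w))"
  by (rule grad_eqI[OF has_derivative_lagrangian])

lemma C1_grad_primal: "C1 grad_primal"
  unfolding grad_primal_def[abs_def]
proof (intro C1_sum)
  fix b :: 'a
  have 1: "C1 (\<lambda>w::'a\<times>'b. Dg (fst w) b)"
    using C1_bounded_linear_comp[OF C1_frechet_derivative_of_C2[OF C2_g] bounded_linear_ident bounded_linear_fst] .
  have 2: "C1 (\<lambda>w::'a\<times>'b. Df (fst w) b)"
    using C1_bounded_linear_comp[OF C1_frechet_derivative_of_C2[OF C2_f] bounded_linear_ident bounded_linear_fst] .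
  have "C1 (\<lambda>w. Dg (fst w) b + snd w \<bullet> Df (fst w) b)"
    by (intro C1_add 1 C1_bounded_bilinear[OF bounded_bilinear_inner] 2
      C1_bounded_linear bounded_linear_snd)
  then show "C1 (\<lambda>w. (Dg (fst w) b + snd w \<bullet> Df (fst w) b) *\<^sub>R b)"
    using C1_bounded_linear_comp[OF _ bounded_linear_scaleR_left bounded_linear_ident] by blast
qed

lemma has_derivative_grad_primal: "(grad_primal has_derivative Dgrad_primal w) (at w)"
  and continuous_on_Dgrad_primal: "continuous_on S (\<lambda>w. Dgrad_primal w v)"
  using C1_frechet_derivative[OF C1_grad_primal] by blast+

lemma linear_Dgrad_primal: "linear (Dgrad_primal w)"
  using has_derivative_grad_primal has_derivative_linear by blast

text \<open>\<open>adjoint\<close> is defined by a choice; the basis expansion exhibits its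
  dependence on \<open>z\<close> and \<open>y\<close>, as continuity and differentiation
  require.\<close>

lemma adjoint_Df: "adjoint (Df z) y = (\<Sum>b\<in>Basis. (y \<bullet> Df z b) *\<^sub>R b)"
proof -
  have "adjoint (Df z) y = (\<Sum>b\<in>Basis. (adjoint (Df z) y \<bullet> b) *\<^sub>R b)"
    by (simp add: euclidean_representation)
  then show ?thesis using adjoint_clauses(2)[OF linear_Df] by simp
qed

text \<open>\<open>grad_primal\<close> is affine in the multiplier, so its derivative in a dual
  direction is its linear part.\<close>

lemma Dgrad_primal_dual: "Dgrad_primal w (0, y) = adjoint (Df (fst w)) y"
proof -
  have lin: "linear (adjoint (Df (fst w)))" using adjoint_linear[OF linear_Df] .
  obtain z l where w: "w = (z, l)" by fastforce
  have 1: "((\<lambda>l. grad_primal (z, l)) has_derivative (\<lambda>y. Dgrad_primal (z, l) (0, y))) (at l)"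
    using has_derivative_compose[OF has_derivative_Pair[OF has_derivative_const has_derivative_ident]
      has_derivative_grad_primal] .
  have "grad_primal (z, l) = (\<Sum>b\<in>Basis. Dg z b *\<^sub>R b) + adjoint (Df z) l" for l
    by (simp add: grad_primal_def adjoint_Df scaleR_add_left sum.distrib)
  moreover have "((\<lambda>l. (\<Sum>b\<in>Basis. Dg z b *\<^sub>R b) + adjoint (Df z) l) has_derivative
      (\<lambda>y. 0 + adjoint (Df z) y)) (at l)"
    using lin w by (intro has_derivative_add has_derivative_const linear_imp_has_derivative) simp
  ultimately have "((\<lambda>l. grad_primal (z, l)) has_derivative (\<lambda>y. 0 + adjoint (Df z) y)) (at l)"
    by simp
  from has_derivative_unique[OF 1 this] show ?thesis using w by (simp add: fun_eq_iff)
qed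

text \<open>Separates the true Hessian of the Lagrangian, \<open>Dgrad_primal w (p, 0)\<close>, from
  the dual part, which agrees with the corresponding block of \<open>kkt_op\<close>.\<close>

lemma Dgrad_primal_split: "Dgrad_primal w v = Dgrad_primal w (fst v, 0) + adjoint (Df (fst w)) (snd v)"
  using linear_add[OF linear_Dgrad_primal, of w "(fst v, 0)" "(0, snd v)"] Dgrad_primal_dual by simp

lemma has_derivative_augmented: "(augmented e1 e2 has_derivative Daugmented e1 e2 w) (at w)"
proof -
  have 2: "((\<lambda>w. f (fst w)) has_derivative (\<lambda>v. Df (fst w) (fst v))) (at w)"
    by (rule has_derivative_compose[OF bounded_linear_imp_has_derivative[OF bounded_linear_fst]
      has_derivative_f])
  have "((\<lambda>w. lagrangian w + e1 / 2 * (f (fst w) \<bullet> f (fst w)) + e2 / 2 * (grad_primal w \<bullet> grad_primal w)) has_derivative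
    (\<lambda>v. v \<bullet> (grad_primal w, f (fst w))
       + e1 / 2 * (f (fst w) \<bullet> Df (fst w) (fst v) + Df (fst w) (fst v) \<bullet> f (fst w))
       + e2 / 2 * (grad_primal w \<bullet> Dgrad_primal w v + Dgrad_primal w v \<bullet> grad_primal w))) (at w)"
    by (intro has_derivative_add has_derivative_lagrangian has_derivative_mult_right has_derivative_inner
        2 has_derivative_grad_primal)
  moreover have "augmented e1 e2 = (\<lambda>w. lagrangian w + e1 / 2 * (f (fst w) \<bullet> f (fst w)) + e2 / 2 * (grad_primal w \<bullet> grad_primal w))"
    by (auto simp: augmented_def fun_eq_iff power2_norm_eq_inner)
  moreover have "Daugmented e1 e2 w = (\<lambda>v. v \<bullet> (grad_primal w, f (fst w))
       + e1 / 2 * (f (fst w) \<bullet> Df (fst w) (fst v) + Df (fst w) (fst v) \<bullet> f (fst w))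
       + e2 / 2 * (grad_primal w \<bullet> Dgrad_primal w v + Dgrad_primal w v \<bullet> grad_primal w))"
    by (auto simp: Daugmented_def fun_eq_iff inner_prod_def inner_commute)
  ultimately show ?thesis by simp
qed

lemma C1_augmented: "C1 (augmented e1 e2)"
proof -
  have f: "continuous_on UNIV (\<lambda>w::'a\<times>'b. f (fst w))"
    by (rule continuous_on_compose2[OF C1_continuous_on[OF C2_imp_C1[OF C2_f], of UNIV]])
      (auto intro: continuous_intros)
  have d: "continuous_on UNIV (\<lambda>w::'a\<times>'b. Df (fst w) v)" for v
    by (rule continuous_on_compose2[OF continuous_on_Df[of UNIV]]) (auto intro: continuous_intros)
  have "continuous_on UNIV (\<lambda>w. Daugmented e1 e2 w v)" for v
    unfolding Daugmented_def
    by (intro continuous_intros f d continuous_on_Dgrad_primal C1_continuous_on[OF C1_grad_primal])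
  then show ?thesis unfolding C1_def using has_derivative_augmented by blast
qed

lemma grad_augmented: "grad (augmented e1 e2) w \<bullet> v = Daugmented e1 e2 w v"
  by (rule grad_inner[OF has_derivative_augmented])

text \<open>Compactness makes pointwise injectivity uniform: the norm attains a positive minimum
  over \<open>K\<close> times the unit sphere, and scaling does the rest.\<close>

lemma uniform_adjoint_lower_bound:
  assumes K: "compact K" and inj: "\<And>z y. adjoint (Df z) y = 0 \<Longrightarrow> y = 0"
  obtains \<sigma> where "0 < \<sigma>" "\<And>z y. z \<in> K \<Longrightarrow> \<sigma> * norm y \<le> norm (adjoint (Df z) y)"
proof (cases "K = {}")
  case True
  then show thesis using that[of 1] by simp
next
  case False
  let ?S = "K \<times> sphere (0::'b) 1"
  let ?q = "\<lambda>u. norm (adjoint (Df (fst u)) (snd u))"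
  obtain b :: 'b where b: "b \<in> Basis" using nonempty_Basis by blast
  then have "b \<in> sphere 0 1" by simp
  then have ne: "?S \<noteq> {}" using False by blast
  have c: "continuous_on ?S (\<lambda>u. Df (fst u) v)" for v
    by (rule continuous_on_compose2[OF continuous_on_Df[of UNIV]]) (auto intro: continuous_intros)
  have "continuous_on ?S ?q"
    unfolding adjoint_Df by (intro continuous_intros c)
  then obtain u where u: "u \<in> ?S" and min: "\<And>u'. u' \<in> ?S \<Longrightarrow> ?q u \<le> ?q u'"
    using continuous_attains_inf[OF compact_Times[OF K compact_sphere] ne] by blast
  have pos: "0 < ?q u" using inj[of "fst u" "snd u"] u by auto
  have "?q u * norm y \<le> norm (adjoint (Df z) y)" if z: "z \<in> K" for z y
  proof (cases "y = 0")
    case False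
    have lin: "linear (adjoint (Df z))" using adjoint_linear[OF linear_Df] .
    have "?q u \<le> ?q (z, y /\<^sub>R norm y)" using z False by (intro min) auto
    also have "\<dots> = norm (adjoint (Df z) y) / norm y"
      by (simp add: linear_scale[OF lin] field_simps)
    finally show ?thesis using False by (simp add: field_simps)
  qed simp
  then show thesis using pos that by blast
qed

end

section \<open>Spectral bounds\<close>

text \<open>\<open>sigma_min\<close> is a \<open>Min\<close>, meaningful for a nonempty finite set;
  nonemptiness comes from here. A minimizer \<open>v\<close> of the quadratic form on the unit
  sphere is an eigenvector, by the first variation in the direction of the eigenvalue residual
  \<open>h\<close>.\<close>

lemma self_adjoint_eigenvector:
  fixes T :: "'b::euclidean_space \<Rightarrow> 'b"
  assumes lin: "linear T" and sym: "\<And>x y. x \<bullet> T y = T x \<bullet> y"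
  shows "\<exists>v c. v \<noteq> 0 \<and> T v = c *\<^sub>R v"
proof -
  have "continuous_on (sphere 0 1) (\<lambda>v. v \<bullet> T v)"
    by (intro continuous_intros linear_continuous_on) (simp add: lin linear_conv_bounded_linear[symmetric])
  moreover obtain b :: 'b where "b \<in> Basis" using nonempty_Basis by blast
  then have "sphere (0::'b) 1 \<noteq> {}" by (metis mem_sphere_0 norm_Basis empty_iff)
  ultimately obtain v where v: "norm v = 1" and min: "\<And>u. norm u = 1 \<Longrightarrow> v \<bullet> T v \<le> u \<bullet> T u"
    using continuous_attains_inf[OF compact_sphere, of 0 1 "\<lambda>v. v \<bullet> T v"] by auto
  define m where "m = v \<bullet> T v"
  have low: "m * (u \<bullet> u) \<le> u \<bullet> T u" for u
  proof (cases "u = 0")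
    case False
    have "m \<le> (u /\<^sub>R norm u) \<bullet> T (u /\<^sub>R norm u)"
      unfolding m_def using False by (intro min) simp
    also have "\<dots> = (u \<bullet> T u) / (norm u)\<^sup>2"
      by (simp add: linear_scale[OF lin] power2_eq_square field_simps)
    finally show ?thesis using False by (simp add: field_simps power2_norm_eq_inner)
  qed (simp add: linear_0[OF lin])
  define h where "h = T v - m *\<^sub>R v"
  define k where "k = h \<bullet> T h - m * (h \<bullet> h)"
  have quad: "0 \<le> 2 * t * (h \<bullet> h) + t\<^sup>2 * k" for t
  proof -
    have vv: "v \<bullet> v = 1" using v by (simp add: norm_eq_1)
    have th: "v \<bullet> T h = h \<bullet> T v" using sym[of v h] by (simp add: inner_commute)
    have hh: "h \<bullet> h = h \<bullet> T v - m * (h \<bullet> v)" by (simp add: h_def inner_diff_right)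
    have "0 \<le> (v + t *\<^sub>R h) \<bullet> T (v + t *\<^sub>R h) - m * ((v + t *\<^sub>R h) \<bullet> (v + t *\<^sub>R h))"
      using low by simp
    also have "\<dots> = (v \<bullet> T v - m * (v \<bullet> v)) + 2 * t * (h \<bullet> T v - m * (h \<bullet> v)) + t\<^sup>2 * k"
      by (simp add: linear_add[OF lin] linear_scale[OF lin] inner_add_left inner_add_right th k_def
        inner_commute[of v h] power2_eq_square algebra_simps)
    finally show ?thesis using vv hh by (simp add: m_def)
  qed
  have "h = 0"
  proof (rule ccontr)
    assume "h \<noteq> 0"
    then have a: "0 < h \<bullet> h" by simp
    \<comment> \<open>For this \<open>t\<close> the factor \<open>t * k\<close> is at most
      \<open>h \<bullet> h\<close> in absolute value and cannot outweigh the
      \<open>2 * (h \<bullet> h)\<close> of the first-order term.\<close>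
    define t where "t = - (h \<bullet> h) / (\<bar>k\<bar> + 1)"
    have "t < 0" using a by (simp add: t_def field_simps)
    have "\<bar>t * k\<bar> = (h \<bullet> h) * (\<bar>k\<bar> / (\<bar>k\<bar> + 1))"
      using a by (simp add: t_def abs_mult abs_divide)
    also have "\<dots> \<le> h \<bullet> h"
      using a by (intro mult_left_le) (auto simp: field_simps)
    finally have "0 < 2 * (h \<bullet> h) + t * k" using a by linarith
    then have "t * (2 * (h \<bullet> h) + t * k) < 0" using \<open>t < 0\<close> by (simp add: mult_neg_pos)
    then show False using quad[of t] by (simp add: power2_eq_square algebra_simps)
  qed
  then show ?thesis using v by (intro exI[of _ v] exI[of _ m]) (auto simp: h_def)
qed

text \<open>Eigenvectors of distinct eigenvalues are orthogonal, hence independent, so there are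
  finitely many.\<close>

lemma finite_eigenvalues:
  fixes T :: "'b::euclidean_space \<Rightarrow> 'b"
  assumes sym: "\<And>x y. x \<bullet> T y = T x \<bullet> y"
  shows "finite {c. \<exists>v. v \<noteq> 0 \<and> T v = c *\<^sub>R v}"
proof -
  let ?E = "{c. \<exists>v. v \<noteq> 0 \<and> T v = c *\<^sub>R v}"
  obtain v where v: "\<And>c. c \<in> ?E \<Longrightarrow> v c \<noteq> 0 \<and> T (v c) = c *\<^sub>R v c"
    using bchoice[of ?E "\<lambda>c v. v \<noteq> 0 \<and> T v = c *\<^sub>R v"] by blast
  have orth: "v c \<bullet> v d = 0" if "c \<in> ?E" "d \<in> ?E" "c \<noteq> d" for c d
    using sym[of "v c" "v d"] v[OF that(1)] v[OF that(2)] that(3) by simp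
  have inj: "inj_on v ?E"
    using orth v by (metis (no_types, lifting) inj_onI inner_eq_zero_iff)
  have "pairwise orthogonal (v ` ?E)"
    using orth by (auto simp: pairwise_def orthogonal_def)
  moreover have "0 \<notin> v ` ?E" using v by force
  ultimately have "finite (v ` ?E)"
    using finiteI_independent pairwise_orthogonal_independent by blast
  then show ?thesis using finite_imageD inj by blast
qed

text \<open>For an eigenvector \<open>v\<close> of \<open>T \<circ> adjoint T\<close> with
  eigenvalue \<open>c\<close>, the number \<open>c * (v \<bullet> v)\<close> is the squared norm of
  \<open>adjoint T v\<close>. Positivity keeps the denominator of \<open>Psi\<close> away from 0,
  where division would return 0.\<close>

lemma sigma_min_pos:
  fixes T :: "'a::euclidean_space \<Rightarrow> 'b::euclidean_space"
  assumes lin: "linear T" and inj: "\<And>y. adjoint T y = 0 \<Longrightarrow> y = 0"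
  shows "0 < sigma_min T"
proof -
  let ?S = "T \<circ> adjoint T"
  let ?E = "{c. \<exists>v. v \<noteq> 0 \<and> ?S v = c *\<^sub>R v}"
  have sym: "x \<bullet> ?S y = ?S x \<bullet> y" for x y
    unfolding o_apply by (metis adjoint_clauses[OF lin])
  have "linear ?S" using lin adjoint_linear[OF lin] by (intro linear_compose)
  then have "?E \<noteq> {}" using self_adjoint_eigenvector[OF _ sym] by blast
  moreover have "finite ?E" by (rule finite_eigenvalues[OF sym])
  moreover have "0 < c" if "c \<in> ?E" for c
  proof -
    obtain v where v: "v \<noteq> 0" "?S v = c *\<^sub>R v" using \<open>c \<in> ?E\<close> by blast
    have "adjoint T v \<bullet> adjoint T v = c * (v \<bullet> v)"
      using v(2) adjoint_works[OF lin, of "adjoint T v" v] by (simp add: inner_commute)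
    moreover have "0 < adjoint T v \<bullet> adjoint T v" "0 < v \<bullet> v" using inj v(1) by auto
    ultimately show "0 < c" by (metis zero_less_mult_pos2)
  qed
  moreover have "{sqrt c | c. \<exists>v. v \<noteq> 0 \<and> T (adjoint T v) = c *\<^sub>R v} = sqrt ` ?E" by auto
  ultimately show ?thesis unfolding sigma_min_def by simp
qed

text \<open>The bound speaks of coefficients in an orthonormal basis of the kernel; expanding
  \<open>p\<close> in it and applying Pythagoras yields the inequality. The basis is finite because
  nonzero orthogonal vectors are independent.\<close>

lemma reduced_hessian_boundD:
  fixes H :: "'a::euclidean_space \<Rightarrow> 'a"
  assumes "reduced_hessian_bound \<gamma> H T" "linear H" "T p = 0"
  shows "\<gamma> * (norm p)\<^sup>2 \<le> p \<bullet> H p"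
proof -
  obtain B where B: "pairwise orthogonal B" "\<And>b. b \<in> B \<Longrightarrow> norm b = 1" "span B = {v. T v = 0}"
    "\<And>c :: 'a \<Rightarrow> real. (\<Sum>a\<in>B. \<Sum>b\<in>B. c a * c b * (a \<bullet> H b)) \<ge> \<gamma> * (\<Sum>b\<in>B. (c b)\<^sup>2)"
    using assms(1) unfolding reduced_hessian_bound_def by blast
  have "0 \<notin> B" using B(2)[of 0] by auto
  then have "finite B"
    using B(1) finiteI_independent pairwise_orthogonal_independent by blast
  then obtain c where p: "p = (\<Sum>b\<in>B. c b *\<^sub>R b)"
    using B(3) assms(3) span_finite[OF \<open>finite B\<close>] by auto
  have "(norm p)\<^sup>2 = (\<Sum>b\<in>B. (norm (c b *\<^sub>R b))\<^sup>2)"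
    unfolding p using B(1) \<open>finite B\<close>
    by (intro norm_sum_Pythagorean) (auto simp: pairwise_def orthogonal_def)
  also have "\<dots> = (\<Sum>b\<in>B. (c b)\<^sup>2)"
    by (intro sum.cong) (auto simp: B(2))
  finally have "(norm p)\<^sup>2 = (\<Sum>b\<in>B. (c b)\<^sup>2)" .
  moreover have "p \<bullet> H p = (\<Sum>a\<in>B. \<Sum>b\<in>B. c a * c b * (a \<bullet> H b))"
    by (simp add: p linear_sum[OF assms(2)] linear_scale[OF assms(2)] inner_sum_left inner_sum_right
      sum_distrib_left mult_ac) (rule trans[OF sum.swap], simp add: mult_ac)
  ultimately show ?thesis using B(4)[of c] by simp
qed

section \<open>Accuracy implies descent\<close>

lemma young_inequality:
  fixes x y t :: real
  assumes "0 < t"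
  shows "x * y \<le> t / 2 * x\<^sup>2 + y\<^sup>2 / (2 * t)"
proof -
  have "0 \<le> (t * x - y)\<^sup>2 / (2 * t)" using assms by simp
  also have "\<dots> = t / 2 * x\<^sup>2 + y\<^sup>2 / (2 * t) - x * y"
    using assms by (simp add: power2_eq_square field_simps)
  finally show ?thesis by simp
qed

text \<open>Norms only: \<open>P\<close> is the tangential step, \<open>A\<close> the primal
  gradient, \<open>c\<close> the infeasibility, \<open>R\<close> the residual bound. Young's
  inequality charges \<open>P\<close> to \<open>\<gamma> * P\<^sup>2\<close> and \<open>A\<close> to
  a fraction of \<open>e2 * A\<^sup>2\<close>; a multiple of \<open>(c + R)\<^sup>2 / e2\<close>
  remains, which \<open>e1 * c\<^sup>2\<close> dominates up to residual terms because
  \<open>e1 * e2\<close> is large.\<close>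

lemma descent_scalar:
  fixes \<gamma> k e1 e2 \<rho> P A c R :: real
  assumes "0 < \<gamma>" "1 \<le> k" "0 \<le> P" "0 \<le> A" "0 \<le> c" "0 \<le> R" "0 < e2" "e2 \<le> 1"
    and e2: "8 * k\<^sup>2 * e2 \<le> \<gamma>" and e1: "8 * (k\<^sup>2 / (2 * \<gamma>) + k + 4 * k\<^sup>2) \<le> e1 * e2"
    and "0 \<le> \<rho>" and \<rho>: "\<rho> * (16000 * (1 + e1 + e2)) \<le> e2" and R: "R \<le> \<rho> * (A + c)"
  shows "- \<gamma> * P\<^sup>2 + k * (P * (c + R) + (c + R)\<^sup>2 + A * (c + R) + e2 * A * P) - e1 * c\<^sup>2 + e1 * c * R
     - e2 * A\<^sup>2 + e2 * A * R \<le> - (e2 * (A\<^sup>2 + c\<^sup>2) / 2)"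
proof -
  define X where "X = c + R"
  \<comment> \<open>The coefficient of \<open>X\<^sup>2\<close> left by Young's inequality is at
    most \<open>l / e2\<close>, because \<open>e2 \<le> 1\<close>; the hypothesis on
    \<open>e1 * e2\<close> reads \<open>8 * l \<le> e1 * e2\<close>.\<close>
  define l where "l = k\<^sup>2 / (2 * \<gamma>) + k + 4 * k\<^sup>2"
  define W where "W = A\<^sup>2 + c\<^sup>2"
  have "0 \<le> k\<^sup>2 / (2 * \<gamma>)" using \<open>0 < \<gamma>\<close> by simp
  then have l1: "1 \<le> l" using \<open>1 \<le> k\<close> unfolding l_def by (smt (verit) zero_le_power2)
  have le: "8 * l \<le> e1 * e2" using e1 by (simp add: l_def)
  have e1_pos: "0 < e1" using le l1 \<open>0 < e2\<close> by (smt (verit) mult_nonpos_nonneg)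
  have e1_ge: "8 * l \<le> e1" using le mult_left_le[OF \<open>e2 \<le> 1\<close>, of e1] e1_pos by linarith
  have W0: "0 \<le> W" by (simp add: W_def)
  have AC: "(A + c)\<^sup>2 \<le> 2 * W" using sum_squares_ge_zero[of "A - c" 0]
    by (simp add: W_def power2_eq_square algebra_simps)
  have Ac: "A * c \<le> W / 2"
    using zero_le_power2[of "A - c"] by (simp add: W_def power2_eq_square algebra_simps)
  have Ac1: "A\<^sup>2 + A * c \<le> 2 * W" and Ac2: "A * c + c\<^sup>2 \<le> 2 * W"
    using Ac zero_le_power2[of A] zero_le_power2[of c] W_def by linarith+
  have X0: "0 \<le> X" using assms by (simp add: X_def)
  have t1: "k * (P * X) \<le> \<gamma> / 2 * P\<^sup>2 + k\<^sup>2 / (2 * \<gamma>) * X\<^sup>2"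
    using young_inequality[OF \<open>0 < \<gamma>\<close>, of P "k * X"] by (simp add: power_mult_distrib mult_ac)
  have t2: "k * (e2 * A * P) \<le> \<gamma> / 2 * P\<^sup>2 + e2 / 16 * A\<^sup>2"
  proof -
    have "k * (e2 * A * P) \<le> \<gamma> / 2 * P\<^sup>2 + (k * e2 * A)\<^sup>2 / (2 * \<gamma>)"
      using young_inequality[OF \<open>0 < \<gamma>\<close>, of P "k * e2 * A"] by (simp add: mult_ac)
    also have "(k * e2 * A)\<^sup>2 / (2 * \<gamma>) = (8 * k\<^sup>2 * e2) * (e2 * A\<^sup>2 / (16 * \<gamma>))"
      using \<open>0 < \<gamma>\<close> by (simp add: power2_eq_square field_simps)
    also have "\<dots> \<le> \<gamma> * (e2 * A\<^sup>2 / (16 * \<gamma>))"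
      using e2 \<open>0 < \<gamma>\<close> \<open>0 < e2\<close> by (intro mult_right_mono) auto
    finally show ?thesis using \<open>0 < \<gamma>\<close> by simp
  qed
  \<comment> \<open>The parameter \<open>e2 / 8\<close> spends a sixteenth of
    \<open>e2 * A\<^sup>2\<close>; the resulting division by \<open>e2\<close> is the origin of the
    condition on \<open>e1 * e2\<close>.\<close>
  have t3: "k * (A * X) \<le> e2 / 16 * A\<^sup>2 + 4 * k\<^sup>2 / e2 * X\<^sup>2"
    using young_inequality[of "e2 / 8" A "k * X"] \<open>0 < e2\<close> by (simp add: power_mult_distrib mult_ac)
  have t4: "k\<^sup>2 / (2 * \<gamma>) * X\<^sup>2 + k * X\<^sup>2 + 4 * k\<^sup>2 / e2 * X\<^sup>2 \<le> l / e2 * X\<^sup>2"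
  proof -
    have "(k\<^sup>2 / (2 * \<gamma>) + k) * e2 \<le> k\<^sup>2 / (2 * \<gamma>) + k"
      using assms by (intro mult_left_le) auto
    then have "k\<^sup>2 / (2 * \<gamma>) + k \<le> (k\<^sup>2 / (2 * \<gamma>) + k) / e2"
      using pos_le_divide_eq[OF \<open>0 < e2\<close>] by blast
    then have "k\<^sup>2 / (2 * \<gamma>) + k + 4 * k\<^sup>2 / e2 \<le> l / e2"
      unfolding l_def by (simp only: add_divide_distrib)
    from mult_right_mono[OF this, of "X\<^sup>2"] show ?thesis by (simp add: algebra_simps)
  qed
  have "\<rho> * (16000 * (1 + e1 + e2)) = 16000 * \<rho> + 16000 * (\<rho> * e1) + 16000 * (\<rho> * e2)"
    by (simp add: algebra_simps)
  moreover have "0 \<le> \<rho> * e1" "0 \<le> \<rho> * e2" using \<open>0 \<le> \<rho>\<close> e1_pos \<open>0 < e2\<close> by auto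
  ultimately have \<rho>1: "\<rho> * e1 \<le> e2 / 16000" and \<rho>2: "\<rho> \<le> e2 / 16000"
    using \<rho> \<open>0 \<le> \<rho>\<close> by linarith+
  have t5: "l / e2 * X\<^sup>2 \<le> e1 / 4 * c\<^sup>2 + e2 / 100 * W"
  proof -
    have "X\<^sup>2 \<le> 2 * c\<^sup>2 + 2 * R\<^sup>2"
      using sum_squares_ge_zero[of "c - R" 0] by (simp add: X_def power2_eq_square algebra_simps)
    also have "R\<^sup>2 \<le> \<rho>\<^sup>2 * (2 * W)"
      using power_mono[OF R \<open>0 \<le> R\<close>, of 2] mult_left_mono[OF AC, of "\<rho>\<^sup>2"] by (simp add: power_mult_distrib)
    finally have "l / e2 * X\<^sup>2 \<le> l / e2 * (2 * c\<^sup>2 + 4 * \<rho>\<^sup>2 * W)"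
      using l1 \<open>0 < e2\<close> by (intro mult_left_mono) auto
    also have "\<dots> = 2 * (l / e2) * c\<^sup>2 + 4 * (l / e2 * \<rho>) * \<rho> * W"
      by (simp add: power2_eq_square algebra_simps)
    also have "2 * (l / e2) * c\<^sup>2 \<le> e1 / 4 * c\<^sup>2"
      using le \<open>0 < e2\<close> by (intro mult_right_mono) (auto simp: field_simps)
    also have "4 * (l / e2 * \<rho>) * \<rho> * W \<le> 4 * 1 * (e2 / 16000) * W"
    proof (intro mult_mono mult_left_mono)
      have "l * \<rho> \<le> e1 * \<rho>" using e1_ge l1 \<open>0 \<le> \<rho>\<close> by (intro mult_right_mono) auto
      then have "l * \<rho> \<le> e2" using \<rho>1 \<open>0 < e2\<close> by (simp add: mult.commute)
      then show "l / e2 * \<rho> \<le> 1" using \<open>0 < e2\<close> by (simp add: field_simps)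
    qed (use \<rho>2 W0 \<open>0 < e2\<close> \<open>0 \<le> \<rho>\<close> l1 in auto)
    also have "4 * 1 * (e2 / 16000) * W \<le> e2 / 100 * W" using W0 \<open>0 < e2\<close> by (intro mult_right_mono) auto
    finally show ?thesis by simp
  qed
  have t6: "e1 * c * R \<le> e2 / 100 * W"
  proof -
    have "e1 * c * R \<le> e1 * c * (\<rho> * (A + c))"
      using R e1_pos \<open>0 \<le> c\<close> by (intro mult_left_mono) auto
    also have "\<dots> = (\<rho> * e1) * (A * c + c\<^sup>2)" by (simp add: power2_eq_square algebra_simps)
    also have "\<dots> \<le> (e2 / 16000) * (2 * W)"
      using \<rho>1 Ac2 \<open>0 < e2\<close> \<open>0 \<le> A\<close> \<open>0 \<le> c\<close> by (intro mult_mono) auto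
    also have "\<dots> \<le> e2 / 100 * W" using mult_nonneg_nonneg[of e2 W] W0 \<open>0 < e2\<close> by (simp add: algebra_simps)
    finally show ?thesis .
  qed
  have t7: "e2 * A * R \<le> e2 / 100 * W"
  proof -
    have "e2 * A * R \<le> e2 * A * (\<rho> * (A + c))"
      using R \<open>0 < e2\<close> \<open>0 \<le> A\<close> by (intro mult_left_mono) auto
    also have "\<dots> = (\<rho> * e2) * (A\<^sup>2 + A * c)" by (simp add: power2_eq_square algebra_simps)
    also have "\<dots> \<le> (e2 / 16000) * (2 * W)"
    proof (intro mult_mono)
      show "\<rho> * e2 \<le> e2 / 16000"
        using mult_left_mono[OF \<open>e2 \<le> 1\<close> \<open>0 \<le> \<rho>\<close>] \<rho>2 by simp
    qed (use Ac1 \<open>0 < e2\<close> \<open>0 \<le> A\<close> \<open>0 \<le> c\<close> in auto)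
    also have "\<dots> \<le> e2 / 100 * W" using mult_nonneg_nonneg[of e2 W] W0 \<open>0 < e2\<close> by (simp add: algebra_simps)
    finally show ?thesis .
  qed
  have t8: "e2 * c\<^sup>2 \<le> e1 * c\<^sup>2" using e1_ge l1 \<open>e2 \<le> 1\<close> by (intro mult_right_mono) auto
  have eW: "e2 * W = e2 * A\<^sup>2 + e2 * c\<^sup>2" by (simp add: W_def algebra_simps)
  have nn: "0 \<le> e2 * A\<^sup>2" "0 \<le> e2 * c\<^sup>2" using \<open>0 < e2\<close> by auto
  have "k * (P * X + X\<^sup>2 + A * X + e2 * A * P) = k * (P * X) + k * X\<^sup>2 + k * (A * X) + k * (e2 * A * P)"
    by (simp add: algebra_simps)
  \<comment> \<open>Balance: \<open>e2 / 8 * A\<^sup>2\<close> and \<open>e1 / 4 * c\<^sup>2\<close>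
    are spent on mixed terms, \<open>3 / 100 * e2 * W\<close> on residual terms. By
    \<open>t8\<close>, more than half of \<open>e2 * W\<close> is left.\<close>
  then have "- \<gamma> * P\<^sup>2 + k * (P * X + X\<^sup>2 + A * X + e2 * A * P) - e1 * c\<^sup>2 + e1 * c * R
     - e2 * A\<^sup>2 + e2 * A * R \<le> - (e2 * W / 2)"
    using t1 t2 t3 t4 t5 t6 t7 t8 eW nn by (simp add: field_simps)
  then show ?thesis by (simp add: X_def W_def)
qed

text \<open>The preimage of minimal norm, \<open>q = adjoint G v\<close> with
  \<open>G (adjoint G v) = y\<close>. Its squared norm is \<open>v \<bullet> y\<close>, while
  \<open>s * norm v \<le> norm q\<close>, and one factor \<open>norm q\<close> cancels.\<close>

lemma adjoint_range_preimage:
  fixes G :: "'a::euclidean_space \<Rightarrow> 'b::euclidean_space"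
  assumes lin: "linear G" and s: "0 < s" and low: "\<And>y. s * norm y \<le> norm (adjoint G y)"
  obtains q where "G q = y" "s * norm q \<le> norm y"
proof -
  have al: "linear (adjoint G)" using adjoint_linear[OF lin] .
  have "inj (G \<circ> adjoint G)"
  proof (subst linear_injective_0)
    show "linear (G \<circ> adjoint G)" using al lin by (rule linear_compose)
    show "\<forall>v. (G \<circ> adjoint G) v = 0 \<longrightarrow> v = 0"
    proof (intro allI impI)
      fix v assume "(G \<circ> adjoint G) v = 0"
      then have "adjoint G v \<bullet> adjoint G v = 0"
        using adjoint_works[OF lin, of "adjoint G v" v] by simp
      then show "v = 0" using low[of v] s by (simp add: mult_le_0_iff)
    qed
  qed
  then have "surj (G \<circ> adjoint G)"
    using linear_injective_imp_surjective[OF linear_compose[OF al lin]] by blast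
  then obtain v where v: "y = G (adjoint G v)" unfolding surj_def o_def by blast
  define q where "q = adjoint G v"
  have "norm q * (s * norm q) \<le> norm q * norm y"
  proof -
    have "norm q * norm q = v \<bullet> y"
      using adjoint_works[OF lin, of q v] v by (simp add: q_def inner_commute flip: power2_eq_square power2_norm_eq_inner)
    also have "\<dots> \<le> norm v * norm y" by (rule norm_cauchy_schwarz)
    finally have "s * (norm q * norm q) \<le> (s * norm v) * norm y" using s by simp
    also have "\<dots> \<le> norm q * norm y" using low[of v] by (intro mult_right_mono) (auto simp: q_def)
    finally show ?thesis by (simp add: mult_ac)
  qed
  then have "s * norm q \<le> norm y" by (cases "q = 0") auto
  then show thesis using that v q_def by blast
qed

text \<open>\<open>M\<close> stands for the modified Hessian, \<open>J\<close> for the true one,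
  \<open>(a, c)\<close> for the gradient of the Lagrangian and \<open>(p, l)\<close> for the
  direction. \<open>L\<close> is chosen before all of these, so one value serves every iterate.
  Inserting the residuals \<open>r1\<close>, \<open>r2\<close> of the linear system produces the
  negative squares of \<open>c\<close> and \<open>a\<close> and the term
  \<open>- (p \<bullet> M p)\<close>; all else is mixed terms.\<close>

lemma descent_estimate:
  fixes s \<gamma> h :: real
  assumes "0 < s" "0 < \<gamma>" "0 \<le> h"
  obtains L where "1 \<le> L"
    "\<And>(G :: 'a::euclidean_space \<Rightarrow> 'b::euclidean_space) M J a c p l e1 e2 \<rho>.
      \<lbrakk>linear G; \<And>y. s * norm y \<le> norm (adjoint G y);
       linear M; \<And>v. G v = 0 \<Longrightarrow> \<gamma> * (norm v)\<^sup>2 \<le> v \<bullet> M v; \<And>v. norm (M v) \<le> h * norm v;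
       norm (J p) \<le> h * norm p;
       0 < e2; L * e2 \<le> 1; L \<le> e1 * e2; 0 \<le> \<rho>; \<rho> * (16000 * (1 + e1 + e2)) \<le> e2;
       norm (M p + adjoint G l + a, G p + c) \<le> \<rho> * norm (a, c)\<rbrakk> \<Longrightarrow>
      a \<bullet> p + c \<bullet> l + e1 * (c \<bullet> G p) + e2 * (a \<bullet> (J p + adjoint G l)) \<le> - (e2 * (norm (a, c))\<^sup>2 / 2)"
proof -
  define \<kappa> where "\<kappa> = 1 / s"
  \<comment> \<open>Dominates all coefficients in the bounds for \<open>p\<close>, \<open>l\<close>
    and \<open>p \<bullet> M p\<close>: they are sums of monomials of its expansion.\<close>
  define k1 where "k1 = (1 + \<kappa>)\<^sup>2 * (1 + h)"
  \<comment> \<open>\<open>t2\<close>, \<open>quad\<close> and \<open>t1\<close> contribute 1 + 2 +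
    2 copies of \<open>k1 * P * X\<close>, the largest count; \<open>2 * h\<close> comes from the
    Hessian difference in \<open>t3\<close>.\<close>
  define k where "k = (5 + 2 * h) * k1"
  \<comment> \<open>The entries give, in this order, \<open>e2 \<le> 1\<close> with
    \<open>e1\<close> positive, and the two conditions of \<open>descent_scalar\<close> on the
    penalties.\<close>
  define L where "L = Max {1, 8 * k\<^sup>2 / \<gamma>, 8 * (k\<^sup>2 / (2 * \<gamma>) + k + 4 * k\<^sup>2)}"
  have \<kappa>: "0 < \<kappa>" using assms by (simp add: \<kappa>_def)
  have k1_expand: "k1 = 1 + 2 * \<kappa> + \<kappa>\<^sup>2 + h + 2 * \<kappa> * h + \<kappa>\<^sup>2 * h"
    by (simp add: k1_def power2_eq_square algebra_simps)
  have pos: "0 \<le> \<kappa>\<^sup>2" "0 \<le> \<kappa> * h" "0 \<le> \<kappa>\<^sup>2 * h" using \<kappa> \<open>0 \<le> h\<close> by auto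
  have k1: "1 \<le> k1" "\<kappa> \<le> k1" "\<kappa> * h \<le> k1" "\<kappa>\<^sup>2 * h \<le> k1" "\<kappa> + \<kappa>\<^sup>2 * h \<le> k1"
    using pos \<kappa> \<open>0 \<le> h\<close> by (auto simp: k1_expand)
  have "1 * 1 \<le> (5 + 2 * h) * k1" using k1 \<open>0 \<le> h\<close> by (intro mult_mono) auto
  then have "1 \<le> k" by (simp add: k_def)
  have L: "1 \<le> L" "8 * k\<^sup>2 / \<gamma> \<le> L" "8 * (k\<^sup>2 / (2 * \<gamma>) + k + 4 * k\<^sup>2) \<le> L"
    unfolding L_def by auto
  show thesis
  proof (rule that[OF L(1)])
    fix G :: "'a \<Rightarrow> 'b" and M J :: "'a \<Rightarrow> 'a" and a c p l and e1 e2 \<rho> :: real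
    assume lin: "linear G" and low: "\<And>y. s * norm y \<le> norm (adjoint G y)"
      and linM: "linear M" and coer: "\<And>v. G v = 0 \<Longrightarrow> \<gamma> * (norm v)\<^sup>2 \<le> v \<bullet> M v"
      and M: "\<And>v. norm (M v) \<le> h * norm v" and J: "norm (J p) \<le> h * norm p"
      and e: "0 < e2" "L * e2 \<le> 1" "L \<le> e1 * e2" and \<rho>: "0 \<le> \<rho>" "\<rho> * (16000 * (1 + e1 + e2)) \<le> e2"
      and res: "norm (M p + adjoint G l + a, G p + c) \<le> \<rho> * norm (a, c)"
    define r1 where "r1 = M p + adjoint G l + a"
    define r2 where "r2 = G p + c"
    define R where "R = \<rho> * norm (a, c)"
    \<comment> \<open>Bounds both \<open>norm (G p)\<close> and \<open>norm r1\<close>.\<close>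
    define X where "X = norm c + R"
    have R: "norm r1 \<le> R" "norm r2 \<le> R"
      using res norm_fst_le[of r1 r2] norm_snd_le[of r2 r1] unfolding R_def r1_def r2_def by linarith+
    have R_le: "R \<le> \<rho> * (norm a + norm c)"
      unfolding R_def using \<rho>(1) norm_Pair_le[of a c] by (intro mult_left_mono)
    have R0: "0 \<le> R" and X0: "0 \<le> X" using \<rho>(1) by (auto simp: R_def X_def)
    have e1_pos: "0 < e1" using e L(1) by (smt (verit) mult_nonpos_nonneg)
    have e2_le: "e2 \<le> 1" using mult_right_mono[OF L(1) less_imp_le[OF e(1)]] e by linarith
    \<comment> \<open>The normal part of the step, controlled by \<open>norm (G p)\<close>; the rest
      \<open>v\<close> lies in the kernel of \<open>G\<close>, where \<open>M\<close> is
      coercive.\<close>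
    obtain q where q: "G q = G p" "s * norm q \<le> norm (G p)"
      using adjoint_range_preimage[OF lin \<open>0 < s\<close> low] by blast
    define v where "v = p - q"
    define P where "P = norm v"
    have p: "p = v + q" by (simp add: v_def)
    have Gv: "G v = 0" using q by (simp add: v_def linear_diff[OF lin])
    have Gp: "G p = r2 - c" by (simp add: r2_def)
    have "norm (G p) \<le> X" using R norm_triangle_ineq4[of r2 c] by (simp add: Gp X_def)
    then have q_le: "norm q \<le> \<kappa> * X"
      using q(2) \<open>0 < s\<close> by (simp add: \<kappa>_def field_simps)
    have p_le0: "norm p \<le> P + \<kappa> * X" using norm_triangle_ineq[of v q] q_le by (simp add: p P_def)
    have p_le: "norm p \<le> k1 * (P + X)"
    proof -
      have "1 * P \<le> k1 * P" "\<kappa> * X \<le> k1 * X" using k1 X0 by (intro mult_right_mono; simp add: P_def)+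
      then show ?thesis using p_le0 by (simp add: distrib_left)
    qed
    \<comment> \<open>The multiplier step is read off from \<open>adjoint G l = r1 - a - M p\<close>
      and the lower bound for \<open>adjoint G\<close>.\<close>
    have l_le: "norm l \<le> k1 * (norm a + X + P)"
    proof -
      have "adjoint G l = r1 - a - M p" by (simp add: r1_def)
      then have "s * norm l \<le> norm (r1 - a - M p)" using low[of l] by simp
      also have "\<dots> \<le> norm r1 + norm a + norm (M p)"
        using norm_triangle_ineq4[of "r1 - a" "M p"] norm_triangle_ineq4[of r1 a] by linarith
      also have "\<dots> \<le> X + norm a + h * (P + \<kappa> * X)"
        using R(1) M[of p] mult_left_mono[OF p_le0 \<open>0 \<le> h\<close>] norm_ge_zero[of c] unfolding X_def by linarith
      finally have "norm l \<le> \<kappa> * (X + norm a + h * (P + \<kappa> * X))"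
        using \<open>0 < s\<close> by (simp add: \<kappa>_def field_simps)
      also have "\<dots> = \<kappa> * norm a + (\<kappa> * h) * P + (\<kappa> + \<kappa>\<^sup>2 * h) * X"
        by (simp add: power2_eq_square algebra_simps)
      also have "\<dots> \<le> k1 * norm a + k1 * P + k1 * X"
        using k1 X0 by (intro add_mono mult_right_mono) (auto simp: P_def)
      finally show ?thesis by (simp add: algebra_simps)
    qed
    have quad: "\<gamma> * P\<^sup>2 - 2 * k1 * P * X - k1 * X\<^sup>2 \<le> p \<bullet> M p"
    proof -
      have b: "\<bar>x \<bullet> M y\<bar> \<le> h * (norm x * norm y)" for x y
        using Cauchy_Schwarz_ineq2[of x "M y"] mult_left_mono[OF M[of y] norm_ge_zero[of x]]
        by (simp add: mult_ac)
      have hk: "h * \<kappa> \<le> k1" "h * \<kappa>\<^sup>2 \<le> k1" using k1 by (simp_all add: mult.commute)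
      have "h * (norm v * norm q) \<le> h * (P * (\<kappa> * X))"
        unfolding P_def using q_le \<open>0 \<le> h\<close> by (intro mult_left_mono) auto
      also have "\<dots> \<le> k1 * P * X"
        using mult_right_mono[OF hk(1), of "P * X"] X0 by (simp add: P_def mult_ac)
      finally have 1: "h * (norm v * norm q) \<le> k1 * P * X" .
      have "h * (norm q * norm q) \<le> h * ((\<kappa> * X) * (\<kappa> * X))"
        using q_le \<open>0 \<le> h\<close> X0 \<kappa> by (intro mult_left_mono mult_mono) auto
      also have "\<dots> \<le> k1 * X\<^sup>2"
        using mult_right_mono[OF hk(2), of "X\<^sup>2"] by (simp add: power2_eq_square mult_ac)
      finally have 2: "h * (norm q * norm q) \<le> k1 * X\<^sup>2" .
      have "p \<bullet> M p = v \<bullet> M v + v \<bullet> M q + q \<bullet> M v + q \<bullet> M q"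
        by (simp add: p linear_add[OF linM] inner_add_left inner_add_right)
      then show ?thesis
        using coer[OF Gv] b[of v q] b[of q v] b[of q q] 1 2 by (simp add: P_def mult.commute[of "norm q" "norm v"])
    qed
    have t1: "2 * (c \<bullet> l) - l \<bullet> r2 \<le> 2 * X * (k1 * (norm a + X + P))"
    proof -
      have "2 * (c \<bullet> l) - l \<bullet> r2 = l \<bullet> (2 *\<^sub>R c - r2)" by (simp add: inner_diff_right inner_commute)
      also have "\<dots> \<le> norm l * norm (2 *\<^sub>R c - r2)" by (rule norm_cauchy_schwarz)
      also have "\<dots> \<le> (k1 * (norm a + X + P)) * (2 * X)"
      proof (intro mult_mono l_le)
        show "norm (2 *\<^sub>R c - r2) \<le> 2 * X"
          using norm_triangle_ineq4[of "2 *\<^sub>R c" r2] R R0 by (simp add: X_def)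
      qed (use k1 X0 in \<open>auto simp: P_def\<close>)
      finally show ?thesis by (simp add: mult_ac)
    qed
    have t2: "r1 \<bullet> p \<le> X * (k1 * (P + X))"
    proof -
      have "r1 \<bullet> p \<le> norm r1 * norm p" by (rule norm_cauchy_schwarz)
      also have "\<dots> \<le> X * (k1 * (P + X))"
        using R(1) X0 by (intro mult_mono p_le) (auto simp: X_def intro: order_trans[of _ R])
      finally show ?thesis .
    qed
    have t3: "e2 * (a \<bullet> (J p - M p)) \<le> 2 * h * k1 * (e2 * norm a * P + norm a * X)"
    proof -
      have "a \<bullet> (J p - M p) \<le> norm a * norm (J p - M p)" by (rule norm_cauchy_schwarz)
      also have "\<dots> \<le> norm a * (2 * h * (k1 * (P + X)))"
        using norm_triangle_ineq4[of "J p" "M p"] J M[of p] mult_left_mono[OF p_le \<open>0 \<le> h\<close>]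
        by (intro mult_left_mono) auto
      finally have "e2 * (a \<bullet> (J p - M p)) \<le> e2 * (norm a * (2 * h * (k1 * (P + X))))"
        using e by (intro mult_left_mono) auto
      also have "\<dots> = 2 * h * k1 * (e2 * norm a * P + e2 * (norm a * X))" by (simp add: algebra_simps)
      also have "\<dots> \<le> 2 * h * k1 * (e2 * norm a * P + 1 * (norm a * X))"
        using e2_le k1 \<open>0 \<le> h\<close> X0 by (intro mult_left_mono add_left_mono mult_right_mono) auto
      finally show ?thesis by simp
    qed
    have t4: "e1 * (c \<bullet> r2) \<le> e1 * norm c * R" "e2 * (a \<bullet> r1) \<le> e2 * norm a * R"
      using norm_cauchy_schwarz[of c r2] mult_left_mono[OF R(2) norm_ge_zero[of c]]
        norm_cauchy_schwarz[of a r1] mult_left_mono[OF R(1) norm_ge_zero[of a]] e1_pos e(1)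
      by (auto simp: mult.assoc)
    \<comment> \<open>Replacing \<open>a\<close> by the first block row creates
      \<open>- (l \<bullet> G p)\<close>, and \<open>G p = r2 - c\<close> turns this into a second
      copy of \<open>c \<bullet> l\<close>; hence the factor 2 in \<open>t1\<close>.\<close>
    have a: "a = r1 - M p - adjoint G l" by (simp add: r1_def)
    have "adjoint G l \<bullet> p = l \<bullet> G p" using adjoint_clauses(2)[OF lin] .
    then have "a \<bullet> p = r1 \<bullet> p - p \<bullet> M p - l \<bullet> G p"
      unfolding a by (simp add: inner_diff_left inner_commute[of "M p"])
    then have 1: "a \<bullet> p = r1 \<bullet> p - p \<bullet> M p - l \<bullet> r2 + c \<bullet> l"
      by (simp add: Gp inner_diff_right inner_commute)
    have 2: "c \<bullet> G p = c \<bullet> r2 - (norm c)\<^sup>2" by (simp add: Gp inner_diff_right power2_norm_eq_inner)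
    have "J p + adjoint G l = (J p - M p) + r1 - a" by (simp add: r1_def)
    then have 3: "a \<bullet> (J p + adjoint G l) = a \<bullet> (J p - M p) + a \<bullet> r1 - (norm a)\<^sup>2"
      by (simp add: inner_diff_right inner_add_right power2_norm_eq_inner)
    have "a \<bullet> p + c \<bullet> l + e1 * (c \<bullet> G p) + e2 * (a \<bullet> (J p + adjoint G l))
      = r1 \<bullet> p - p \<bullet> M p + (2 * (c \<bullet> l) - l \<bullet> r2) + e1 * (c \<bullet> r2) - e1 * (norm c)\<^sup>2
        + e2 * (a \<bullet> (J p - M p)) + e2 * (a \<bullet> r1) - e2 * (norm a)\<^sup>2"
      unfolding 1 2 3 by (simp add: algebra_simps)
    also have "\<dots> \<le> X * (k1 * (P + X)) - (\<gamma> * P\<^sup>2 - 2 * k1 * P * X - k1 * X\<^sup>2)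
        + 2 * X * (k1 * (norm a + X + P)) + e1 * norm c * R - e1 * (norm c)\<^sup>2
        + 2 * h * k1 * (e2 * norm a * P + norm a * X) + e2 * norm a * R - e2 * (norm a)\<^sup>2"
      using quad t1 t2 t3 t4 by linarith
    also have "\<dots> \<le> - \<gamma> * P\<^sup>2 + k * (P * X + X\<^sup>2 + norm a * X + e2 * norm a * P)
        - e1 * (norm c)\<^sup>2 + e1 * norm c * R - e2 * (norm a)\<^sup>2 + e2 * norm a * R"
    proof -
      have n: "0 \<le> h * k1 * (P * X)" "0 \<le> h * k1 * X\<^sup>2" "0 \<le> k1 * (norm a * X)" "0 \<le> k1 * X\<^sup>2"
        "0 \<le> k1 * (e2 * norm a * P)"
        using k1 \<open>0 \<le> h\<close> X0 e by (auto simp: P_def)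
      then show ?thesis unfolding k_def by (simp add: power2_eq_square algebra_simps)
    qed
    also have "\<dots> \<le> - (e2 * ((norm a)\<^sup>2 + (norm c)\<^sup>2) / 2)"
      unfolding X_def
    proof (rule descent_scalar[OF \<open>0 < \<gamma>\<close> \<open>1 \<le> k\<close> _ norm_ge_zero norm_ge_zero R0 e(1) e2_le _ _ \<rho> R_le])
      show "0 \<le> P" by (simp add: P_def)
      have "8 * k\<^sup>2 / \<gamma> * e2 \<le> L * e2" using L e by (intro mult_right_mono) auto
      then have "8 * k\<^sup>2 / \<gamma> * e2 \<le> 1" using e by linarith
      then show "8 * k\<^sup>2 * e2 \<le> \<gamma>" using \<open>0 < \<gamma>\<close> by (simp add: field_simps)
      show "8 * (k\<^sup>2 / (2 * \<gamma>) + k + 4 * k\<^sup>2) \<le> e1 * e2" using L e by linarith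
    qed
    also have "(norm a)\<^sup>2 + (norm c)\<^sup>2 = (norm (a, c))\<^sup>2" by (simp add: norm_Pair)
    finally show "a \<bullet> p + c \<bullet> l + e1 * (c \<bullet> G p) + e2 * (a \<bullet> (J p + adjoint G l))
      \<le> - (e2 * (norm (a, c))\<^sup>2 / 2)" .
  qed
qed

section \<open>Backtracking line search\<close>

text \<open>The difference quotient tends to \<open>D d\<close>, which is strictly below
  \<open>\<beta> * D d\<close>.\<close>

lemma armijo_step_exists:
  fixes \<phi> :: "'a::real_normed_vector \<Rightarrow> real"
  assumes "(\<phi> has_derivative D) (at w)" "D d < 0" "\<beta> < 1"
  shows "\<exists>\<alpha>. 0 < \<alpha> \<and> \<alpha> \<le> 1 \<and> \<phi> (w + \<alpha> *\<^sub>R d) \<le> \<phi> w + \<alpha> * \<beta> * D d"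
proof -
  have "((\<lambda>t. w + t *\<^sub>R d) has_derivative (\<lambda>t. t *\<^sub>R d)) (at 0)"
    by (auto intro!: derivative_eq_intros)
  moreover have "(\<phi> has_derivative D) (at (w + 0 *\<^sub>R d))" using assms by simp
  ultimately have "((\<lambda>t. \<phi> (w + t *\<^sub>R d)) has_derivative (\<lambda>t. D (t *\<^sub>R d))) (at 0)"
    by (rule has_derivative_compose)
  moreover have "(\<lambda>t. D (t *\<^sub>R d)) = (*) (D d)"
    using assms(1) has_derivative_linear linear_scale by (fastforce simp: fun_eq_iff)
  ultimately have "((\<lambda>t. \<phi> (w + t *\<^sub>R d)) has_real_derivative D d) (at 0)"
    by (simp add: has_field_derivative_def)
  then have "((\<lambda>t. (\<phi> (w + t *\<^sub>R d) - \<phi> w) / t) \<longlongrightarrow> D d) (at_right 0)"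
    by (auto simp: DERIV_def intro: tendsto_within_subset)
  moreover have "D d < \<beta> * D d" using mult_strict_right_mono_neg[OF assms(3,2)] by simp
  ultimately have "\<forall>\<^sub>F t in at_right 0. (\<phi> (w + t *\<^sub>R d) - \<phi> w) / t < \<beta> * D d"
    by (rule order_tendstoD)
  then obtain b where "b > 0" and b: "\<And>t. 0 < t \<Longrightarrow> t < b \<Longrightarrow> (\<phi> (w + t *\<^sub>R d) - \<phi> w) / t < \<beta> * D d"
    unfolding eventually_at_right_field by auto
  define t where "t = min (b / 2) 1"
  have t: "0 < t" "t < b" "t \<le> 1" using \<open>b > 0\<close> by (auto simp: t_def)
  then have "\<phi> (w + t *\<^sub>R d) - \<phi> w < \<beta> * D d * t"
    using b[OF t(1,2)] by (simp add: pos_divide_less_eq)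
  then show ?thesis using t by (intro exI[of _ t]) (auto simp: mult_ac)
qed

text \<open>The merit values decrease and converge, so step size times \<open>(r n)\<^sup>2\<close>
  tends to 0. Where \<open>r n\<close> is at least \<open>e\<close>, a rejected step forces, by the
  mean value theorem, a definite change of the gradient; uniform continuity then forbids that step
  to be short, so \<open>r n\<close> must drop below \<open>e\<close> eventually.\<close>

lemma backtracking_convergence:
  fixes \<phi> :: "'a::euclidean_space \<Rightarrow> real" and r :: "nat \<Rightarrow> real"
  assumes der: "\<And>x. (\<phi> has_derivative D x) (at x)" and cont: "\<And>v. continuous_on UNIV (\<lambda>x. D x v)"
    and K: "compact K" "\<And>n t. 0 \<le> t \<Longrightarrow> t \<le> 1 \<Longrightarrow> w n + t *\<^sub>R d n \<in> K"
    and param: "0 < \<beta>" "\<beta> < 1" "0 < \<delta>" "\<delta> < 1" "0 < \<kappa>"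
    and desc: "\<And>n. D (w n) (d n) \<le> - \<kappa> * (r n)\<^sup>2" and "\<And>n. 0 \<le> r n"
    and armijo: "\<And>n. \<phi> (w n + \<delta> ^ j n *\<^sub>R d n) \<le> \<phi> (w n) + \<delta> ^ j n * \<beta> * D (w n) (d n)"
    and not_armijo: "\<And>n i. i < j n \<Longrightarrow> \<not> \<phi> (w n + \<delta> ^ i *\<^sub>R d n) \<le> \<phi> (w n) + \<delta> ^ i * \<beta> * D (w n) (d n)"
    and step: "\<And>n. w (Suc n) = w n + \<delta> ^ j n *\<^sub>R d n"
  shows "r \<longlonglongrightarrow> 0"
proof -
  have wK: "w n \<in> K" for n using K(2)[of 0 n] by simp
  define \<alpha> where "\<alpha> n = \<delta> ^ j n" for n
  have \<alpha>: "0 < \<alpha> n" "\<alpha> n \<le> 1" for n using param by (auto simp: \<alpha>_def power_le_one)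
  have dec: "\<alpha> n * (r n)\<^sup>2 * (\<beta> * \<kappa>) \<le> \<phi> (w n) - \<phi> (w (Suc n))" for n
  proof -
    have "\<alpha> n * \<beta> * D (w n) (d n) \<le> \<alpha> n * \<beta> * (- \<kappa> * (r n)\<^sup>2)"
      using desc \<alpha>[of n] param by (intro mult_left_mono) auto
    then show ?thesis using armijo[of n] by (simp add: step \<alpha>_def mult_ac)
  qed
  have "continuous_on K \<phi>"
    using der by (meson continuous_at_imp_continuous_on has_derivative_continuous)
  then have "bounded (\<phi> ` K)" using K(1) compact_imp_bounded compact_continuous_image by blast
  then obtain B where B: "\<And>x. x \<in> K \<Longrightarrow> \<bar>\<phi> x\<bar> \<le> B" by (auto simp: bounded_iff)
  have nn: "0 \<le> \<alpha> n * (r n)\<^sup>2 * (\<beta> * \<kappa>)" for n using \<alpha>[of n] param by auto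
  have "decseq (\<lambda>n. \<phi> (w n))"
    using dec nn by (intro decseq_SucI) (smt (verit))
  moreover have "\<And>n. - B \<le> \<phi> (w n)" using B wK by (metis abs_le_D2 minus_le_iff)
  ultimately obtain l where l: "(\<lambda>n. \<phi> (w n)) \<longlonglongrightarrow> l"
    using decseq_convergent[of "\<lambda>n. \<phi> (w n)" "- B"] by blast
  have "(\<lambda>n. \<phi> (w n) - \<phi> (w (Suc n))) \<longlonglongrightarrow> l - l"
    by (intro tendsto_diff l LIMSEQ_Suc)
  then have lim0: "(\<lambda>n. \<phi> (w n) - \<phi> (w (Suc n))) \<longlonglongrightarrow> 0" by simp
  have "(\<lambda>n. \<alpha> n * (r n)\<^sup>2 * (\<beta> * \<kappa>)) \<longlonglongrightarrow> 0"
    by (rule tendsto_sandwich[OF always_eventually always_eventually tendsto_const lim0])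
      (use dec nn in auto)
  then have "(\<lambda>n. \<alpha> n * (r n)\<^sup>2 * (\<beta> * \<kappa>) / (\<beta> * \<kappa>)) \<longlonglongrightarrow> 0 / (\<beta> * \<kappa>)"
    using param by (intro tendsto_divide tendsto_const) auto
  then have lim: "(\<lambda>n. \<alpha> n * (r n)\<^sup>2) \<longlonglongrightarrow> 0" using param by simp
  \<comment> \<open>Both \<open>w n\<close> and \<open>w n + d n\<close> lie in \<open>K\<close>,
    which bounds their difference; the maximum with 1 allows division by \<open>d0\<close>.\<close>
  obtain d0 where d0: "\<And>n. norm (d n) \<le> d0" "0 < d0"
  proof -
    obtain b where b: "\<And>x. x \<in> K \<Longrightarrow> norm x \<le> b"
      using compact_imp_bounded[OF K(1)] by (auto simp: bounded_iff)
    have "norm (d n) \<le> 2 * b" for n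
      using norm_triangle_ineq4[of "w n + d n" "w n"] b[OF wK[of n]] b[OF K(2)[of 1 n]] by simp
    then show thesis by (intro that[of "max (2 * b) 1"]) (auto simp: le_max_iff_disj)
  qed
  \<comment> \<open>Collects the directional derivatives into one vector field, to which uniform
    continuity on \<open>K\<close> applies.\<close>
  define Df where "Df x = (\<Sum>b\<in>Basis. D x b *\<^sub>R b)" for x
  have D: "D x v = Df x \<bullet> v" for x v
  proof -
    have lin: "linear (D x)" using der has_derivative_linear by blast
    have "D x v = D x (\<Sum>b\<in>Basis. (v \<bullet> b) *\<^sub>R b)" by (simp add: euclidean_representation)
    also have "\<dots> = Df x \<bullet> v"
      by (simp add: linear_sum[OF lin] linear_scale[OF lin] Df_def inner_sum_left inner_commute[of v] mult.commute)
    finally show ?thesis .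
  qed
  have "continuous_on K Df"
    unfolding Df_def using cont continuous_on_subset by (intro continuous_intros) blast
  then have unif: "uniformly_continuous_on K Df" using K(1) compact_uniformly_continuous by blast
  show ?thesis
  proof (rule LIMSEQ_I)
    fix e :: real assume "0 < e"
    \<comment> \<open>If \<open>e \<le> r n\<close>, a rejected trial step changes \<open>Df\<close>
      by more than \<open>e'\<close> at some point of its segment.\<close>
    define e' where "e' = (1 - \<beta>) * \<kappa> * e\<^sup>2 / d0"
    have "0 < e'" using \<open>0 < e\<close> param d0 by (simp add: e'_def)
    then obtain t0 where t0: "0 < t0" "\<And>x y. x \<in> K \<Longrightarrow> y \<in> K \<Longrightarrow> dist x y < t0 \<Longrightarrow> dist (Df x) (Df y) < e'"
      using unif unfolding uniformly_continuous_on_def by metis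
    \<comment> \<open>The accepted step is \<open>\<delta>\<close> times the last rejected one,
      which is at least \<open>t0 / d0\<close>; the entry 1 covers acceptance at the initial
      trial.\<close>
    define a0 where "a0 = min 1 (\<delta> * t0 / d0)"
    have a0: "0 < a0" using t0 d0 param by (simp add: a0_def)
    have low: "a0 \<le> \<alpha> n" if n: "e \<le> r n" for n
    proof (cases "j n")
      case 0
      then show ?thesis by (simp add: \<alpha>_def a0_def)
    next
      case (Suc i)
      define t where "t = \<delta> ^ i"
      have t: "0 < t" "t \<le> 1" using param by (auto simp: t_def power_le_one)
      have fail: "\<phi> (w n) + t * \<beta> * D (w n) (d n) < \<phi> (w n + t *\<^sub>R d n)"
        using not_armijo[of i n] Suc by (simp add: t_def not_le)
      have dt: "((\<lambda>t. \<phi> (w n + t *\<^sub>R d n)) has_real_derivative D (w n + x *\<^sub>R d n) (d n)) (at x)" for x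
      proof -
        have "((\<lambda>t. w n + t *\<^sub>R d n) has_derivative (\<lambda>t. t *\<^sub>R d n)) (at x)"
          by (auto intro!: derivative_eq_intros)
        from has_derivative_compose[OF this der]
        have "((\<lambda>t. \<phi> (w n + t *\<^sub>R d n)) has_derivative (\<lambda>t. D (w n + x *\<^sub>R d n) (t *\<^sub>R d n))) (at x)" .
        moreover have "(\<lambda>t. D (w n + x *\<^sub>R d n) (t *\<^sub>R d n)) = (*) (D (w n + x *\<^sub>R d n) (d n))"
          by (auto simp: fun_eq_iff D)
        ultimately show ?thesis by (simp add: has_field_derivative_def)
      qed
      obtain x where x: "0 < x" "x < t"
        and mvt: "\<phi> (w n + t *\<^sub>R d n) - \<phi> (w n + 0 *\<^sub>R d n) = (t - 0) * D (w n + x *\<^sub>R d n) (d n)"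
        using MVT2[OF t(1), of "\<lambda>t. \<phi> (w n + t *\<^sub>R d n)" "\<lambda>x. D (w n + x *\<^sub>R d n) (d n)"] dt by blast
      have "t * (\<beta> * D (w n) (d n)) < t * D (w n + x *\<^sub>R d n) (d n)"
        using fail mvt by (simp add: mult_ac)
      then have "\<beta> * D (w n) (d n) < D (w n + x *\<^sub>R d n) (d n)" using t by simp
      then have "(1 - \<beta>) * - D (w n) (d n) < (Df (w n + x *\<^sub>R d n) - Df (w n)) \<bullet> d n"
        by (simp add: D inner_diff_left algebra_simps)
      also have "\<dots> \<le> dist (Df (w n + x *\<^sub>R d n)) (Df (w n)) * d0"
        unfolding dist_norm
        by (rule order_trans[OF norm_cauchy_schwarz mult_left_mono[OF d0(1) norm_ge_zero]])
      finally have less: "(1 - \<beta>) * - D (w n) (d n) < dist (Df (w n + x *\<^sub>R d n)) (Df (w n)) * d0" .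
      have "\<kappa> * e\<^sup>2 \<le> \<kappa> * (r n)\<^sup>2" using n \<open>0 < e\<close> param by (intro mult_left_mono power_mono) auto
      then have "\<kappa> * e\<^sup>2 \<le> - D (w n) (d n)" using desc[of n] by simp
      then have "(1 - \<beta>) * (\<kappa> * e\<^sup>2) \<le> (1 - \<beta>) * - D (w n) (d n)"
        using param by (intro mult_left_mono) auto
      also note less
      finally have "e' < dist (Df (w n + x *\<^sub>R d n)) (Df (w n))"
        using d0 by (simp add: e'_def pos_divide_less_eq mult_ac)
      then have "t0 \<le> dist (w n + x *\<^sub>R d n) (w n)"
        using t0(2)[OF K(2)[of x n] wK[of n]] x t by force
      also have "\<dots> = x * norm (d n)" using x by (simp add: dist_norm)
      also have "\<dots> \<le> t * d0" using x d0 by (intro mult_mono) auto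
      finally have "t0 / d0 \<le> t" using d0 by (simp add: pos_divide_le_eq)
      then have "\<delta> * (t0 / d0) \<le> \<delta> * t" using param by (intro mult_left_mono) auto
      then have "\<delta> * (t0 / d0) \<le> \<alpha> n" using Suc by (simp add: \<alpha>_def t_def)
      then show ?thesis by (simp add: a0_def)
    qed
    have "0 < a0 * e\<^sup>2" using a0 \<open>0 < e\<close> by simp
    from LIMSEQ_D[OF lim this] obtain n0 where n0: "\<And>n. n \<ge> n0 \<Longrightarrow> \<bar>\<alpha> n * (r n)\<^sup>2\<bar> < a0 * e\<^sup>2" by auto
    have "r n < e" if "n \<ge> n0" for n
    proof (rule ccontr)
      assume "\<not> r n < e"
      then have "a0 * e\<^sup>2 \<le> \<alpha> n * (r n)\<^sup>2"
        using low[of n] a0 \<open>0 < e\<close> by (intro mult_mono power_mono) auto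
      then show False using n0[OF that] by linarith
    qed
    then show "\<exists>n0. \<forall>n\<ge>n0. norm (r n - 0) < e"
      using \<open>\<And>n. 0 \<le> r n\<close> by (intro exI[of _ n0]) auto
  qed
qed

section \<open>The nonlinear dynamic program\<close>

lemma stage_no_less: "stage_no (s :: 'n::finite) < CARD('n)"
  using stage_no_bij(1) by (auto simp: bij_betw_def)

lemma stage_no_le: "stage_no (s :: 'n::finite option) \<le> CARD('n)"
  using stage_no_bij(2)[where 'n='n] by (auto simp: bij_betw_def)

lemma stage_no_stage_ix: "k \<le> CARD('n) \<Longrightarrow> stage_no (stage_ix k :: 'n::finite option) = k"
  using stage_no_bij(2)[where 'n='n]
  by (metis atMost_iff bij_betw_imp_surj_on to_nat_on_from_nat_into)

lemma bounded_linear_xs: "bounded_linear (\<lambda>z. xs z k)"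
  unfolding xs_def by (intro bounded_linear_compose[OF bounded_linear_vec_nth] bounded_linear_fst)

lemma bounded_linear_us: "bounded_linear (\<lambda>z. us z k)"
  unfolding us_def by (intro bounded_linear_compose[OF bounded_linear_vec_nth] bounded_linear_snd)

lemma bounded_linear_stage: "bounded_linear (\<lambda>z. (xs z k, us z k))"
  by (intro bounded_linear_Pair bounded_linear_xs bounded_linear_us)

lemma C2_total_cost:
  assumes "C3_problem CARD('n) P"
  shows "C2 (total_cost P :: ('n::finite, 'x::finite, 'u::finite) primal \<Rightarrow> real)"
  unfolding total_cost_def[abs_def] using assms
  by (intro C2_add C2_sum
      C2_bounded_linear_comp[OF C3_imp_C2 bounded_linear_ident bounded_linear_stage]
      C2_bounded_linear_comp[OF C3_imp_C2 bounded_linear_ident bounded_linear_xs])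
    (auto simp: C3_problem_def)

lemma C2_constr:
  assumes "C3_problem CARD('n) P"
  shows "C2 (constr P :: ('n::finite, 'x::finite, 'u::finite) primal \<Rightarrow> ('n, 'x) dual)"
  unfolding constr_def[abs_def]
proof (rule C2_vec_lambda)
  fix s :: "'n option"
  show "C2 (\<lambda>z::('n, 'x, 'u) primal. case stage_no s of 0 \<Rightarrow> xs z 0 - init_state P
     | Suc k \<Rightarrow> xs z (Suc k) - dyn P k (xs z k, us z k))"
  proof (cases "stage_no s")
    case 0
    have "C2 (\<lambda>z::('n, 'x, 'u) primal. xs z 0 + - init_state P)"
      by (intro C2_add C2_bounded_linear bounded_linear_xs C2_const)
    then show ?thesis using 0 by simp
  next
    case (Suc k)
    then have "k < CARD('n)" using stage_no_le[of s] by simp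
    then have "C2 (dyn P k)" using assms C3_imp_C2 by (auto simp: C3_problem_def)
    note C2_bounded_linear_comp[OF this bounded_linear_minus[OF bounded_linear_ident] bounded_linear_stage]
    from C2_add[OF C2_bounded_linear[OF bounded_linear_xs] this]
    have "C2 (\<lambda>z::('n, 'x, 'u) primal. xs z (Suc k) + - dyn P k (xs z k, us z k))" .
    then show ?thesis using Suc by simp
  qed
qed

text \<open>The shape matters: the row of each later stage is an identity block at that stage minus
  a term depending on the preceding stage alone.\<close>

lemma Gop_nth:
  fixes z p :: "('n::finite, 'x::finite, 'u::finite) primal"
  assumes "C3_problem CARD('n) P"
  shows "Gop P z p $ s = (case stage_no s of 0 \<Rightarrow> xs p 0
     | Suc k \<Rightarrow> xs p (Suc k) - frechet_derivative (dyn P k) (at (xs z k, us z k)) (xs p k, us p k))"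
proof -
  have "(constr P has_derivative Gop P z) (at z)"
    unfolding Gop_def using C1_frechet_derivative(1)[OF C2_imp_C1[OF C2_constr[OF assms]]] .
  from bounded_linear.has_derivative[OF bounded_linear_vec_nth this]
  have 1: "((\<lambda>z. constr P z $ s) has_derivative (\<lambda>p. Gop P z p $ s)) (at z)" .
  show ?thesis
  proof (cases "stage_no s")
    case 0
    then have "constr P z $ s = xs z 0 - init_state P" for z :: "('n, 'x, 'u) primal"
      by (simp add: constr_def)
    moreover have "((\<lambda>z. xs z 0 - init_state P) has_derivative (\<lambda>p. xs p 0 - 0)) (at z)"
      by (intro has_derivative_diff has_derivative_const bounded_linear_imp_has_derivative bounded_linear_xs)
    ultimately have "((\<lambda>z. constr P z $ s) has_derivative (\<lambda>p. xs p 0)) (at z)" by simp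
    from fun_cong[OF has_derivative_unique[OF 1 this], of p] show ?thesis using 0 by simp
  next
    case (Suc k)
    then have "k < CARD('n)" using stage_no_le[of s] by simp
    then have "C1 (dyn P k)" using assms C3_imp_C2 C2_imp_C1 by (auto simp: C3_problem_def)
    note d = C1_frechet_derivative(1)[OF this]
    have "constr P z $ s = xs z (Suc k) - dyn P k (xs z k, us z k)" for z :: "('n, 'x, 'u) primal"
      using Suc by (simp add: constr_def)
    moreover have "((\<lambda>z. xs z (Suc k) - dyn P k (xs z k, us z k)) has_derivative
      (\<lambda>p. xs p (Suc k) - frechet_derivative (dyn P k) (at (xs z k, us z k)) (xs p k, us p k))) (at z)"
      by (intro has_derivative_diff bounded_linear_imp_has_derivative bounded_linear_xs
        has_derivative_compose[OF bounded_linear_imp_has_derivative[OF bounded_linear_stage] d])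
    ultimately have "((\<lambda>z. constr P z $ s) has_derivative
      (\<lambda>p. xs p (Suc k) - frechet_derivative (dyn P k) (at (xs z k, us z k)) (xs p k, us p k))) (at z)"
      by simp
    from fun_cong[OF has_derivative_unique[OF 1 this], of p] show ?thesis using Suc by simp
  qed
qed

lemma linear_Gop:
  assumes "C3_problem CARD('n) P"
  shows "linear (Gop P z :: ('n::finite, 'x::finite, 'u::finite) primal \<Rightarrow> ('n, 'x) dual)"
  unfolding Gop_def
  using C1_frechet_derivative(1)[OF C2_imp_C1[OF C2_constr[OF assms]]] has_derivative_linear by blast

text \<open>The linearized dynamics with right-hand side \<open>y\<close> are solved forward in time
  with zero controls; \<open>xr\<close> is the resulting trajectory.\<close>

lemma surj_Gop:
  assumes "C3_problem CARD('n) P"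
  shows "surj (Gop P z :: ('n::finite, 'x::finite, 'u::finite) primal \<Rightarrow> ('n, 'x) dual)"
  unfolding surj_def
proof
  fix y :: "('n, 'x) dual"
  define xr where "xr = rec_nat (ls y 0)
    (\<lambda>k v. ls y (Suc k) + frechet_derivative (dyn P k) (at (xs z k, us z k)) (v, 0))"
  define p :: "('n, 'x, 'u) primal" where "p = ((\<chi> s. xr (stage_no s)), 0)"
  have p: "xs p k = xr k" if "k \<le> CARD('n)" for k
    using that by (simp add: xs_def p_def stage_no_stage_ix)
  have u: "us p k = 0" for k by (simp add: us_def p_def)
  have y: "y $ s = ls y (stage_no s)" for s by (simp add: ls_def)
  have "y = Gop P z p"
  proof (subst vec_eq_iff, rule allI)
    fix s show "y $ s = Gop P z p $ s"
      using stage_no_le[of s] y[of s]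
      by (simp add: Gop_nth[OF assms] p u xr_def split: nat.split)
  qed
  then show "\<exists>p. y = Gop P z p" by blast
qed

text \<open>The kernel of the adjoint is orthogonal to the range, which is the whole space.\<close>

lemma adjoint_Gop_inj:
  fixes y :: "('n::finite, 'x::finite) dual" and z :: "('n, 'x, 'u::finite) primal"
  assumes "C3_problem CARD('n) P" "adjoint (Gop P z) y = 0"
  shows "y = 0"
proof -
  obtain p where "y = Gop P z p" using surj_Gop[OF assms(1)] unfolding surj_def by blast
  then have "y \<bullet> y = adjoint (Gop P z) y \<bullet> p"
    using adjoint_clauses(2)[OF linear_Gop[OF assms(1)], of z y p] by simp
  then show ?thesis using assms(2) by simp
qed

section \<open>Bounds on the modified Hessian, the KKT operator and the accuracy threshold\<close>

lemma linear_hm_op: "linear (hm_op H :: ('n::finite, 'x::finite, 'u::finite) primal \<Rightarrow> _)"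
proof (rule linearI)
  fix z z' :: "('n, 'x, 'u) primal" and c :: real
  have [simp]: "xs (z + z') k = xs z k + xs z' k" "us (z + z') k = us z k + us z' k"
    "xs (c *\<^sub>R z) k = c *\<^sub>R xs z k" "us (c *\<^sub>R z) k = c *\<^sub>R us z k" for k
    by (simp_all add: xs_def us_def)
  show "hm_op H (z + z') = hm_op H z + hm_op H z'"
    by (simp add: hm_op_def hm_block_def Let_def vec_eq_iff matrix_vector_right_distrib)
  show "hm_op H (c *\<^sub>R z) = c *\<^sub>R hm_op H z"
    by (simp add: hm_op_def hm_block_def Let_def vec_eq_iff matrix_vector_mult_scaleR algebra_simps)
qed

lemma linear_hm_block: "linear (hm_block H k)"
  by (rule linearI) (simp_all add: hm_block_def matrix_vector_right_distrib matrix_vector_mult_scaleR algebra_simps)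

lemma norm_vec_le_card:
  fixes v :: "'a::real_normed_vector^'n"
  assumes "\<And>i. norm (v $ i) \<le> c"
  shows "norm v \<le> real CARD('n) * c"
proof -
  have "norm v \<le> (\<Sum>i\<in>UNIV. norm (v $ i))"
    unfolding norm_vec_def by (intro L2_set_le_sum) auto
  also have "\<dots> \<le> (\<Sum>i\<in>(UNIV::'n set). c)" using assms by (intro sum_mono)
  finally show ?thesis by simp
qed

text \<open>Crude on purpose, as the aim is a constant independent of the iteration: each of the
  \<open>CARD('n) + 1\<close> state blocks and \<open>CARD('n)\<close> control blocks is at most
  \<open>2 * U * norm p\<close>.\<close>

lemma norm_hm_op_le:
  fixes z p :: "('n::finite, 'x::finite, 'u::finite) primal"
  assumes "bounded_data P U H z" "0 \<le> U"
  shows "norm (hm_op H p) \<le> (4 * real CARD('n) + 2) * U * norm p"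
proof -
  let ?c = "2 * U * norm p"
  have x: "norm (xs p k) \<le> norm p" for k
    unfolding xs_def by (rule order_trans[OF Finite_Cartesian_Product.norm_nth_le])
      (metis norm_fst_le prod.collapse)
  have u: "norm (us p k) \<le> norm p" for k
    unfolding us_def by (rule order_trans[OF Finite_Cartesian_Product.norm_nth_le])
      (metis norm_snd_le prod.collapse)
  have b: "norm (hm_block H k (xs p k, us p k)) \<le> ?c" if "k < CARD('n)" for k
  proof -
    have "norm (hm_block H k (xs p k, us p k)) \<le> onorm (hm_block H k) * norm (xs p k, us p k)"
      using linear_hm_block by (intro onorm) (simp add: linear_conv_bounded_linear[symmetric])
    also have "\<dots> \<le> U * (norm p + norm p)"
      using assms that x[of k] u[of k] norm_Pair_le[of "xs p k" "us p k"]
      by (intro mult_mono) (auto simp: bounded_data_def)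
    finally show ?thesis by simp
  qed
  have b1: "norm (fst (hm_block H k (xs p k, us p k))) \<le> ?c"
    and b2: "norm (snd (hm_block H k (xs p k, us p k))) \<le> ?c" if "k < CARD('n)" for k
    using b[OF that] norm_fst_le norm_snd_le by (metis order_trans prod.collapse)+
  have b3: "norm (Qh H CARD('n) *v xs p CARD('n)) \<le> ?c"
  proof -
    have "norm (Qh H CARD('n) *v xs p CARD('n)) \<le> spec_norm (Qh H CARD('n)) * norm (xs p CARD('n))"
      by (intro onorm matrix_vector_mul_bounded_linear)
    also have "\<dots> \<le> U * norm p"
      using assms x by (intro mult_mono) (auto simp: bounded_data_def)
    also have "\<dots> \<le> ?c" using assms(2) by simp
    finally show ?thesis .
  qed
  have "norm (fst (hm_op H p) $ s) \<le> ?c" for s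
    using stage_no_le[of s] b1[of "stage_no s"] b3 by (auto simp: hm_op_def Let_def)
  then have "norm (fst (hm_op H p)) \<le> real CARD('n option) * ?c" by (rule norm_vec_le_card)
  moreover have "norm (snd (hm_op H p) $ s) \<le> ?c" for s
    using stage_no_less[of s] b2[of "stage_no s"] by (auto simp: hm_op_def Let_def)
  then have "norm (snd (hm_op H p)) \<le> real CARD('n) * ?c" by (rule norm_vec_le_card)
  ultimately show ?thesis
    using norm_Pair_le[of "fst (hm_op H p)" "snd (hm_op H p)"]
    by (simp add: card_UNIV_option algebra_simps)
qed

lemma linear_kkt_op:
  assumes "C3_problem CARD('n) P"
  shows "linear (kkt_op P H (z :: ('n::finite, 'x::finite, 'u::finite) primal))"
  using linear_add[OF linear_hm_op] linear_scale[OF linear_hm_op]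
    linear_add[OF linear_Gop[OF assms]] linear_scale[OF linear_Gop[OF assms]]
    linear_add[OF adjoint_linear[OF linear_Gop[OF assms]]]
    linear_scale[OF adjoint_linear[OF linear_Gop[OF assms]]]
  by (intro linearI) (auto simp: kkt_op_def algebra_simps)

text \<open>The state of the last stage enters the constraints only through the identity block.\<close>

lemma onorm_kkt_op_ge_1:
  assumes "C3_problem CARD('n) P"
  shows "1 \<le> onorm (kkt_op P H (z :: ('n::finite, 'x::finite, 'u::finite) primal))"
proof -
  obtain e :: "real^'x" where e: "norm e = 1" using nonempty_Basis norm_Basis by blast
  obtain k where k: "CARD('n) = Suc k" using zero_less_card_finite[where 'a='n] gr0_implies_Suc by blast
  let ?s = "stage_ix CARD('n) :: 'n option"
  let ?p = "(axis ?s e, 0) :: ('n, 'x, 'u) primal"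
  have ne: "stage_ix k \<noteq> ?s"
    using stage_no_stage_ix[of k, where 'n='n] stage_no_stage_ix[of "CARD('n)", where 'n='n] k by force
  have "(xs ?p k, us ?p k) = 0" using ne by (simp add: xs_def us_def axis_def zero_prod_def)
  moreover have "C1 (dyn P k)" using assms C3_imp_C2 C2_imp_C1 k by (auto simp: C3_problem_def)
  then have "linear (frechet_derivative (dyn P k) (at u))" for u
    using C1_frechet_derivative(1) has_derivative_linear by blast
  ultimately have "Gop P z ?p $ ?s = e"
    using k stage_no_stage_ix[of "CARD('n)", where 'n='n] linear_0
    by (auto simp: Gop_nth[OF assms] xs_def axis_def)
  have na: "norm (axis ?s e) = 1" using e by (simp add: norm_eq_1 inner_axis_axis)
  from \<open>Gop P z ?p $ ?s = e\<close> have "1 \<le> norm (Gop P z ?p)" using Finite_Cartesian_Product.norm_nth_le[of "Gop P z ?p" ?s] e by simp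
  also have "\<dots> \<le> norm (kkt_op P H z (?p, 0))"
    unfolding kkt_op_def using norm_snd_le by simp
  also have "\<dots> \<le> onorm (kkt_op P H z) * norm (?p, 0 :: ('n, 'x) dual)"
    using linear_kkt_op[OF assms] by (intro onorm) (simp add: linear_conv_bounded_linear[symmetric])
  also have "norm (?p, 0 :: ('n, 'x) dual) = 1" using na by (simp add: norm_Pair)
  finally show ?thesis by simp
qed

text \<open>Both factors of the denominator are at most 1 and positive, the second one thanks to
  \<open>sigma_min_pos\<close>.\<close>

lemma Psi_ge_20:
  assumes "C3_problem CARD('n) P" "0 < gamma_rh C"
  shows "20 \<le> Psi P C H (w :: ('n::finite, 'x::finite, 'u::finite) pd)"
proof -
  have "0 < sigma_min (Gop P (fst w))"
    using sigma_min_pos[OF linear_Gop] adjoint_Gop_inj assms(1) by blast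
  then have "0 < min (gamma_rh C) 1 * min ((sigma_min (Gop P (fst w)))\<^sup>2) 1"
    using assms(2) by simp
  moreover have "min (gamma_rh C) 1 * min ((sigma_min (Gop P (fst w)))\<^sup>2) 1 \<le> 1 * 1"
    using assms(2) by (intro mult_mono) auto
  ultimately show ?thesis unfolding Psi_def by (simp add: pos_le_divide_eq)
qed

lemma Upsilon_ge_1: "1 \<le> Upsilon P H w"
  unfolding Upsilon_def by (intro Max_ge) auto

text \<open>400 is the square of the lower bound \<open>20 * 1\<close> of
  \<open>Psi * Upsilon\<close>, and the factor \<open>1 / 2 - beta C\<close>, at most one half,
  doubles it to 800.\<close>

lemma eps_max_bounds:
  fixes w :: "('n::finite, 'x::finite, 'u::finite) pd"
  assumes "C3_problem CARD('n) P" "valid_params N C" "0 < e1" "0 < e2"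
  shows "0 \<le> eps_max P C H w e1 e2" "eps_max P C H w e1 e2 * (800 * (1 + e1 + e2)) \<le> e2"
proof -
  have \<beta>: "0 < beta C" "beta C < 1 / 2" and "0 < gamma_rh C" using assms(2) by (auto simp: valid_params_def)
  let ?q = "(Psi P C H w * Upsilon P H w)\<^sup>2"
  have "20 * 1 \<le> Psi P C H w * Upsilon P H w"
    using Psi_ge_20[OF assms(1) \<open>0 < gamma_rh C\<close>, of H w] Upsilon_ge_1[of P H w]
    by (intro mult_mono) linarith+
  then have q: "400 \<le> ?q" using power_mono[of 20 "Psi P C H w * Upsilon P H w" 2] by simp
  show "0 \<le> eps_max P C H w e1 e2" unfolding eps_max_def using assms \<beta> by auto
  have cancel: "a / (x * y) * x = a / y" if "x \<noteq> 0" for a x y :: real using that by simp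
  have "eps_max P C H w e1 e2 * (1 + e1 + e2) = (1 / 2 - beta C) * e2 / ?q"
    unfolding eps_max_def using assms cancel by simp
  also have "\<dots> \<le> (1 / 2) * e2 / 400"
    using q assms \<beta> by (intro frac_le mult_right_mono) auto
  finally have "800 * (eps_max P C H w e1 e2 * (1 + e1 + e2)) \<le> e2" by simp
  then show "eps_max P C H w e1 e2 * (800 * (1 + e1 + e2)) \<le> e2" by (simp only: mult.left_commute)
qed

section \<open>The staged program as an instance of the abstract problem\<close>

lemma lagr_eq:
  assumes "nlp (total_cost P) (constr P :: ('n::finite, 'x::finite, 'u::finite) primal \<Rightarrow> ('n, 'x) dual)"
  shows "(lagr P :: ('n, 'x, 'u) pd \<Rightarrow> real) = nlp.lagrangian (total_cost P) (constr P)"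
  by (rule ext) (simp only: lagr_def nlp.lagrangian_def[OF assms])

lemma merit_eq:
  assumes "nlp (total_cost P) (constr P :: ('n::finite, 'x::finite, 'u::finite) primal \<Rightarrow> ('n, 'x) dual)"
  shows "(merit P e1 e2 :: ('n, 'x, 'u) pd \<Rightarrow> real) = nlp.augmented (total_cost P) (constr P) e1 e2"
  by (rule ext) (simp only: merit_def nlp.augmented_def[OF assms] lagr_eq[OF assms] nlp.grad_lagrangian[OF assms]
    fst_conv snd_conv)

lemma nlp_problem:
  assumes "C3_problem CARD('n) P"
  shows "nlp (total_cost P) (constr P :: ('n::finite, 'x::finite, 'u::finite) primal \<Rightarrow> ('n, 'x) dual)"
  using C2_total_cost[OF assms] C2_constr[OF assms] by unfold_locales

text \<open>Supplies \<open>descent_estimate\<close> with uniform constants: compactness of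
  \<open>K\<close> bounds the adjoint of \<open>Gop\<close> from below and the true Hessian from
  above, \<open>bounded_data\<close> bounds the modified Hessian.\<close>

lemma uniform_descent:
  fixes P :: "('x::finite, 'u::finite) ocp" and K :: "('n::finite, 'x, 'u) pd set"
  assumes P: "C3_problem CARD('n) P" and C: "valid_params N C" and "0 \<le> U" and "compact K"
  obtains L where "1 \<le> L"
    "\<And>H w (s :: ('n, 'x, 'u) aotd_state).
      \<lbrakk>w \<in> K; reduced_hessian_bound (gamma_rh C) (hm_op H) (Gop P (fst w)); bounded_data P U H (fst w);
       0 < eta1 s; 0 < eta2 s; L * eta2 s \<le> 1; L \<le> eta1 s * eta2 s;
       tol s \<le> eps_max P C H w (eta1 s) (eta2 s); accurate P C H w s\<rbrakk> \<Longrightarrow> descent P w s"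
proof -
  interpret nlp "total_cost P" "constr P :: ('n, 'x, 'u) primal \<Rightarrow> ('n, 'x) dual"
    using nlp_problem[OF P] .
  note lagr = lagr_eq[OF nlp_axioms] and merit = merit_eq[OF nlp_axioms]
  have Df: "Df z = Gop P z" for z :: "('n, 'x, 'u) primal" by (simp add: Gop_def)
  have \<gamma>: "0 < gamma_rh C" using C by (simp add: valid_params_def)
  have inj: "adjoint (Df z) y = 0 \<Longrightarrow> y = 0" for z :: "('n, 'x, 'u) primal" and y
    unfolding Df by (rule adjoint_Gop_inj[OF P])
  have K1: "compact (fst ` K)"
    using \<open>compact K\<close> by (intro compact_continuous_image continuous_intros)
  obtain \<sigma> where \<sigma>: "0 < \<sigma>"
    "\<And>z y. z \<in> fst ` K \<Longrightarrow> \<sigma> * norm y \<le> norm (adjoint (Gop P z) y)"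
  proof (rule uniform_adjoint_lower_bound[OF K1 inj])
    fix \<sigma> assume "0 < \<sigma>" "\<And>z y. z \<in> fst ` K \<Longrightarrow> \<sigma> * norm y \<le> norm (adjoint (Df z) y)"
    then show thesis using that unfolding Df by blast
  qed
  have lin: "linear (\<lambda>p. Dgrad_primal w (p, 0))" for w
  proof (rule linearI)
    show "Dgrad_primal w (p + q, 0) = Dgrad_primal w (p, 0) + Dgrad_primal w (q, 0)" for p q
      using linear_add[OF linear_Dgrad_primal, of w "(p, 0)" "(q, 0)"] by simp
    show "Dgrad_primal w (c *\<^sub>R p, 0) = c *\<^sub>R Dgrad_primal w (p, 0)" for c p
      using linear_scale[OF linear_Dgrad_primal, of w c "(p, 0)"] by simp
  qed
  obtain h1 where h1: "0 \<le> h1" "\<And>w p. w \<in> K \<Longrightarrow> norm (Dgrad_primal w (p, 0)) \<le> h1 * norm p"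
  proof (rule compact_linear_bound[OF \<open>compact K\<close> lin continuous_on_Dgrad_primal])
    fix B assume "0 \<le> B" "\<And>w p. w \<in> K \<Longrightarrow> norm (Dgrad_primal w (p, 0)) \<le> B * norm p"
    then show thesis using that by blast
  qed
  define h where "h = max h1 ((4 * real CARD('n) + 2) * U)"
  have "0 \<le> h" using h1 by (simp add: h_def)
  obtain L where L: "1 \<le> L"
    "\<And>(G :: ('n, 'x, 'u) primal \<Rightarrow> ('n, 'x) dual) M J a c p l e1 e2 \<rho>.
      \<lbrakk>linear G; \<And>y. \<sigma> * norm y \<le> norm (adjoint G y);
       linear M; \<And>v. G v = 0 \<Longrightarrow> gamma_rh C * (norm v)\<^sup>2 \<le> v \<bullet> M v; \<And>v. norm (M v) \<le> h * norm v;
       norm (J p) \<le> h * norm p;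
       0 < e2; L * e2 \<le> 1; L \<le> e1 * e2; 0 \<le> \<rho>; \<rho> * (16000 * (1 + e1 + e2)) \<le> e2;
       norm (M p + adjoint G l + a, G p + c) \<le> \<rho> * norm (a, c)\<rbrakk> \<Longrightarrow>
      a \<bullet> p + c \<bullet> l + e1 * (c \<bullet> G p) + e2 * (a \<bullet> (J p + adjoint G l)) \<le> - (e2 * (norm (a, c))\<^sup>2 / 2)"
    using descent_estimate[OF \<sigma>(1) \<gamma> \<open>0 \<le> h\<close>, where 'a="('n, 'x, 'u) primal" and 'b="('n, 'x) dual"]
    by blast
  show thesis
  proof (rule that[OF L(1)])
    fix H w and s :: "('n, 'x, 'u) aotd_state"
    assume w: "w \<in> K" and red: "reduced_hessian_bound (gamma_rh C) (hm_op H) (Gop P (fst w))"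
      and bd: "bounded_data P U H (fst w)" and e: "0 < eta1 s" "0 < eta2 s" "L * eta2 s \<le> 1" "L \<le> eta1 s * eta2 s"
      and tol: "tol s \<le> eps_max P C H w (eta1 s) (eta2 s)" and acc: "accurate P C H w s"
    let ?G = "Gop P (fst w)" and ?c = "constr P (fst w)"
      and ?p = "fst (direction s)" and ?l = "snd (direction s)"
    \<comment> \<open>16000 = 800 * 20, with 800 from \<open>eps_max_bounds\<close> and 20 from the
      lower bound of \<open>o'\<close>, the denominator of the accuracy test.\<close>
    define \<rho> where "\<rho> = eta2 s / (16000 * (1 + eta1 s + eta2 s))"
    define o' where "o' = onorm (kkt_op P H (fst w)) * Psi P C H w"
    have o': "20 \<le> o'"
      unfolding o'_def using mult_mono[OF onorm_kkt_op_ge_1[OF P, of H "fst w"] Psi_ge_20[OF P \<gamma>, of H w]]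
        onorm_kkt_op_ge_1[OF P, of H "fst w"] by simp
    let ?e = "eps_max P C H w (eta1 s) (eta2 s)"
    have pos: "0 < 1 + eta1 s + eta2 s" using e by linarith
    have e20: "?e / 20 \<le> \<rho>" "0 \<le> ?e"
      using eps_max_bounds[OF P C e(1,2), of H w] pos by (auto simp: \<rho>_def field_simps)
    have "norm (residual P H w s) \<le> tol s * norm (grad (lagr P) w) / o'"
      using acc by (simp add: accurate_def o'_def)
    also have "\<dots> \<le> ?e * norm (grad (lagr P) w) / 20"
      using tol o' e20 by (intro frac_le mult_right_mono) auto
    also have "\<dots> \<le> \<rho> * norm (grad (lagr P) w)"
      using mult_right_mono[OF e20(1) norm_ge_zero[of "grad (lagr P) w"]] by simp
    finally have "norm (hm_op H ?p + adjoint ?G ?l + grad_primal w, ?G ?p + ?c) \<le> \<rho> * norm (grad_primal w, ?c)"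
      by (simp add: residual_def kkt_op_def lagr grad_lagrangian)
    then have "grad_primal w \<bullet> ?p + ?c \<bullet> ?l + eta1 s * (?c \<bullet> ?G ?p)
        + eta2 s * (grad_primal w \<bullet> (Dgrad_primal w (?p, 0) + adjoint ?G ?l)) \<le> - (eta2 s * (norm (grad_primal w, ?c))\<^sup>2 / 2)"
    \<comment> \<open>The rotation moves the residual inequality to the front, where the chained
      fact discharges it.\<close>
    proof (rule L(2)[where \<rho>=\<rho>, OF linear_Gop[OF P] _ linear_hm_op _ _ _ e(2-4), rotated -1])
      show "0 \<le> \<rho>" using e pos by (simp add: \<rho>_def)
      show "\<rho> * (16000 * (1 + eta1 s + eta2 s)) \<le> eta2 s" using pos by (simp add: \<rho>_def)
      show "\<sigma> * norm y \<le> norm (adjoint ?G y)" for y using \<sigma>(2) w by blast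
      show "gamma_rh C * (norm v)\<^sup>2 \<le> v \<bullet> hm_op H v" if "?G v = 0" for v
        using reduced_hessian_boundD[OF red linear_hm_op that] .
      show "norm (hm_op H v) \<le> h * norm v" for v :: "('n, 'x, 'u) primal"
        using norm_hm_op_le[OF bd \<open>0 \<le> U\<close>, of v]
        by (rule order_trans) (auto simp: h_def intro: mult_right_mono)
      show "norm (Dgrad_primal w (?p, 0)) \<le> h * norm ?p"
        using h1(2)[OF w, of ?p] by (rule order_trans) (auto simp: h_def intro: mult_right_mono)
    qed
    then show "descent P w s"
      using Dgrad_primal_split[of w "direction s"]
      by (simp add: descent_def merit grad_augmented Daugmented_def lagr grad_lagrangian Df)
  qed
qed


section \<open>Convergence of AOTD\<close>

lemma accuracy_steps_params:
  assumes "(accuracy_step P C H w)\<^sup>*\<^sup>* s t"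
  shows "eta1 t = eta1 s \<and> eta2 t = eta2 s \<and> tol t = tol s"
  using assms by induction (auto simp: accuracy_step_def refine_def Let_def)

text \<open>\<open>m\<close> is the number of penalty updates since the start, where the penalties were \<open>a\<close> and \<open>b\<close>.\<close>

definition shrunk :: "aotd_params \<Rightarrow> real \<Rightarrow> real \<Rightarrow> nat \<Rightarrow> ('n, 'x, 'u) aotd_state \<Rightarrow> bool" where
  "shrunk C a b m s \<longleftrightarrow> eta1 s = nu C ^ (2 * m) * a \<and> eta2 s = b / nu C ^ m"

text \<open>\<open>good\<close> forbids an update at the count \<open>m0\<close>, and counts grow by
  one, so \<open>m0\<close> is never passed. The bound on \<open>tol\<close> belongs to the
  invariant because \<open>good\<close> asks for it; \<open>shrink\<close> restores it through its
  minimum.\<close>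

lemma outer_steps_shrunk:
  assumes "(outer_step P C H w)\<^sup>*\<^sup>* s s'"
    and good: "\<And>t. shrunk C a b m0 t \<Longrightarrow> tol t \<le> eps_max P C H w (eta1 t) (eta2 t) \<Longrightarrow>
      accurate P C H w t \<Longrightarrow> descent P w t"
    and "shrunk C a b m s" "tol s \<le> eps_max P C H w (eta1 s) (eta2 s)" "m \<le> m0"
  shows "\<exists>m'. m \<le> m' \<and> m' \<le> m0 \<and> shrunk C a b m' s' \<and> tol s' \<le> eps_max P C H w (eta1 s') (eta2 s')"
  using assms(1)
proof induction
  case base
  then show ?case using assms by blast
next
  case (step s1 s2)
  then obtain m1 where m1: "m \<le> m1" "m1 \<le> m0" "shrunk C a b m1 s1"
    "tol s1 \<le> eps_max P C H w (eta1 s1) (eta2 s1)" by blast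
  obtain t where t: "(accuracy_step P C H w)\<^sup>*\<^sup>* s1 t" "accurate P C H w t"
    "s2 = (if descent P w t then t else shrink P C H w t)"
    using step(2) unfolding outer_step_def by blast
  have t': "shrunk C a b m1 t" "tol t \<le> eps_max P C H w (eta1 t) (eta2 t)"
    using accuracy_steps_params[OF t(1)] m1 by (simp_all add: shrunk_def)
  show ?case
  proof (cases "descent P w t")
    case True
    then have "s2 = t" using t(3) by simp
    then show ?thesis using t' m1 by blast
  next
    case False
    then have "m1 \<noteq> m0" using good[OF _ t'(2) t(2)] t'(1) by metis
    moreover have s2: "s2 = shrink P C H w t" using False t(3) by simp
    have "shrunk C a b (Suc m1) s2"
      using t'(1) unfolding s2 by (simp add: shrink_def Let_def shrunk_def power2_eq_square)
    moreover have "tol s2 \<le> eps_max P C H w (eta1 s2) (eta2 s2)"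
      unfolding s2 by (simp add: shrink_def Let_def)
    ultimately show ?thesis using m1 by (intro exI[of _ "Suc m1"]) auto
  qed
qed

text \<open>The cap \<open>eps_max\<close> depends on the iterate, so the bound on the carried
  \<open>tol\<close> may be lost at a new one; \<open>prepare\<close> restores it without touching
  the penalties.\<close>

lemma shrunk_prepare:
  fixes w :: "('n::finite, 'x::finite, 'u::finite) pd"
  assumes "C3_problem CARD('n) P" "valid_params N C" "0 < eta1 s" "0 < eta2 s"
  shows "shrunk C a b m (prepare P C H w s) \<longleftrightarrow> shrunk C a b m s"
    and "tol (prepare P C H w s) \<le> eps_max P C H w (eta1 (prepare P C H w s)) (eta2 (prepare P C H w s))"
proof -
  let ?e = "eps_max P C H w (eta1 s) (eta2 s)"
  have "0 \<le> ?e" using eps_max_bounds(1)[OF assms] .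
  have "1 < nu C" using assms(2) by (simp add: valid_params_def)
  then have "?e * 1 \<le> ?e * nu C" using \<open>0 \<le> ?e\<close> by (intro mult_left_mono) auto
  then have "?e / nu C \<le> ?e" using \<open>1 < nu C\<close> by (simp add: pos_divide_le_eq)
  then show "tol (prepare P C H w s) \<le> eps_max P C H w (eta1 (prepare P C H w s)) (eta2 (prepare P C H w s))"
    by (simp add: prepare_def Let_def)
  show "shrunk C a b m (prepare P C H w s) \<longleftrightarrow> shrunk C a b m s"
    by (simp add: prepare_def Let_def shrunk_def)
qed

theorem theorem1:
  fixes P :: "('x::finite, 'u::finite) ocp"
    and C :: aotd_params
    and H :: "nat \<Rightarrow> ('x, 'u) hess_mod"
    and s0 :: "('n::finite, 'x, 'u) aotd_state"
    and w :: "nat \<Rightarrow> ('n, 'x, 'u) pd"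
    and s :: "nat \<Rightarrow> ('n, 'x, 'u) aotd_state"
    and T :: enat
    and \<gamma>\<^sub>C U :: real
    and t\<^sub>C :: nat
  assumes parameters: "valid_params CARD('n) C"
    and start: "valid_start C s0"
    and run: "aotd_run P C H s0 w s T"
    and modification: "\<And>\<tau>. enat \<tau> < T \<Longrightarrow> hessian_modification P (gamma_rh C) (H \<tau>) (w \<tau>)"
    and reduced_hessian:
      "\<And>\<tau>. enat \<tau> < T \<Longrightarrow> reduced_hessian_bound (gamma_rh C) (hm_op (H \<tau>)) (Gop P (fst (w \<tau>)))"
    and controllability: "0 < \<gamma>\<^sub>C" "\<gamma>\<^sub>C \<le> 1" "1 \<le> t\<^sub>C" "t\<^sub>C \<le> CARD('n)"
      "\<And>\<tau>. enat \<tau> < T \<Longrightarrow> controllable P \<gamma>\<^sub>C t\<^sub>C (fst (w \<tau>))"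
    and boundedness: "2 \<le> U" "\<And>\<tau>. enat \<tau> < T \<Longrightarrow> bounded_data P U (H \<tau>) (fst (w \<tau>))"
    and smoothness: "C3_problem CARD('n) P" "compact_region P U w s T"
    and mu: "mu C \<ge> 32 * U ^ (4 * t\<^sub>C + 1) / \<gamma>\<^sub>C"
  shows "(\<forall>\<tau>. enat \<tau> < T \<longrightarrow> (\<exists>\<alpha>. 0 < \<alpha> \<and> \<alpha> \<le> 1 \<and> armijo P C (w \<tau>) (s \<tau>) \<alpha>)) \<and>
         (T = \<infinity> \<longrightarrow> (\<lambda>\<tau>. norm (grad (lagr P) (w \<tau>))) \<longlonglongrightarrow> 0)"
proof -
  interpret nlp "total_cost P" "constr P :: ('n, 'x, 'u) primal \<Rightarrow> ('n, 'x) dual"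
    using nlp_problem[OF smoothness(1)] .
  note merit = merit_eq[OF nlp_axioms]
  have "0 \<le> U" using boundedness(1) by simp
  have C: "0 < beta C" "beta C < 1" "0 < delta C" "delta C < 1" "1 < nu C" "0 \<le> tol_kkt C"
    using parameters by (auto simp: valid_params_def)
  obtain K :: "('n, 'x, 'u) pd set" where "compact K"
    and K: "\<And>\<tau> \<alpha>. enat \<tau> < T \<Longrightarrow> 0 \<le> \<alpha> \<Longrightarrow> \<alpha> \<le> 1 \<Longrightarrow> w \<tau> + \<alpha> *\<^sub>R direction (s \<tau>) \<in> K"
    using smoothness(2) unfolding compact_region_def Let_def by (metis atLeastAtMost_iff)
  obtain L where L: "1 \<le> L"
    "\<And>H w (s :: ('n, 'x, 'u) aotd_state).
      \<lbrakk>w \<in> K; reduced_hessian_bound (gamma_rh C) (hm_op H) (Gop P (fst w)); bounded_data P U H (fst w);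
       0 < eta1 s; 0 < eta2 s; L * eta2 s \<le> 1; L \<le> eta1 s * eta2 s;
       tol s \<le> eps_max P C H w (eta1 s) (eta2 s); accurate P C H w s\<rbrakk> \<Longrightarrow> descent P w s"
    using uniform_descent[OF smoothness(1) parameters \<open>0 \<le> U\<close> \<open>compact K\<close>] by metis
  define a b where "a = eta1 s0" and "b = eta2 s0"
  have ab: "0 < a" "0 < b" using start by (auto simp: a_def b_def valid_start_def)
  have shrunk_pos: "0 < eta1 t \<and> 0 < eta2 t" if "shrunk C a b m t" for m and t :: "('n, 'x, 'u) aotd_state"
    using that ab C by (simp add: shrunk_def)
  \<comment> \<open>After \<open>m\<close> updates, \<open>eta2\<close> is
    \<open>b / nu C ^ m\<close> and \<open>eta1 * eta2\<close> is \<open>nu C ^ m * (a * b)\<close>;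
    this \<open>m0\<close> takes both past the thresholds set by \<open>L\<close>.\<close>
  obtain m0 where m0: "max (L * b) (L / (a * b)) < nu C ^ m0"
    using real_arch_pow[OF C(5)] by blast
  have good: "descent P (w \<tau>) t"
    if \<tau>: "enat \<tau> < T" and sh: "shrunk C a b m0 t"
      and tol: "tol t \<le> eps_max P C (H \<tau>) (w \<tau>) (eta1 t) (eta2 t)" and acc: "accurate P C (H \<tau>) (w \<tau>) t" for \<tau> t
  proof (rule L(2)[OF _ reduced_hessian[OF \<tau>] boundedness(2)[OF \<tau>] _ _ _ _ tol acc])
    have p: "0 < nu C ^ m0" using C by simp
    show "w \<tau> \<in> K" using K[OF \<tau>, of 0] by simp
    show "0 < eta1 t" "0 < eta2 t" using shrunk_pos[OF sh] by auto
    show "L * eta2 t \<le> 1" using m0 sh p by (simp add: shrunk_def pos_divide_le_eq)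
    have "L / (a * b) < nu C ^ m0" using m0 by simp
    then have "L < nu C ^ m0 * (a * b)" using ab by (simp add: pos_divide_less_eq)
    also have "\<dots> = eta1 t * eta2 t" using sh p by (simp add: shrunk_def mult_2 power_add)
    finally show "L \<le> eta1 t * eta2 t" by simp
  qed
  define carried where "carried \<tau> = (case \<tau> of 0 \<Rightarrow> s0 | Suc \<tau>' \<Rightarrow> s \<tau>')" for \<tau>
  have accepts: "accepts P C (H \<tau>) (w \<tau>) (carried \<tau>) (s \<tau>)" if "enat \<tau> < T" for \<tau>
    using run that by (auto simp: aotd_run_def carried_def)
  have step: "\<exists>m'. m \<le> m' \<and> m' \<le> m0 \<and> shrunk C a b m' (s \<tau>)"
    if \<tau>: "enat \<tau> < T" and m: "m \<le> m0" "shrunk C a b m (carried \<tau>)" for m \<tau>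
  proof -
    have pos: "0 < eta1 (carried \<tau>)" "0 < eta2 (carried \<tau>)" using shrunk_pos[OF m(2)] by auto
    note prep = shrunk_prepare[OF smoothness(1) parameters pos]
    have "(outer_step P C (H \<tau>) (w \<tau>))\<^sup>*\<^sup>* (prepare P C (H \<tau>) (w \<tau>) (carried \<tau>)) (s \<tau>)"
      using accepts[OF \<tau>] by (simp add: accepts_def)
    from outer_steps_shrunk[OF this good[OF \<tau>] prep(1)[THEN iffD2, OF m(2)] prep(2) m(1)]
    show ?thesis by blast
  qed
  have "shrunk C a b 0 (carried 0)" by (simp add: carried_def shrunk_def a_def b_def)
  then have base: "\<exists>m'. m' \<le> m0 \<and> shrunk C a b m' (s 0)" if "enat 0 < T" using step[OF that] by blast
  have inv: "\<exists>m'. m' \<le> m0 \<and> shrunk C a b m' (s \<tau>)" if "enat \<tau> < T" for \<tau>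
    using that
  proof (induction \<tau>)
    case (Suc \<tau>)
    then have "enat \<tau> < T" by (meson enat_ord_simps(2) lessI less_trans)
    then obtain m where "m \<le> m0" "shrunk C a b m (carried (Suc \<tau>))"
      using Suc.IH by (auto simp: carried_def)
    then show ?case using step[OF Suc.prems] by blast
  qed (use base in simp)
  have desc: "Daugmented (eta1 (s \<tau>)) (eta2 (s \<tau>)) (w \<tau>) (direction (s \<tau>))
      \<le> - (eta2 (s \<tau>) / 2) * (norm (grad (lagr P) (w \<tau>)))\<^sup>2" if "enat \<tau> < T" for \<tau>
    using accepts[OF that] by (simp add: accepts_def descent_def merit grad_augmented)
  have armijo_iff: "armijo P C v t \<alpha> \<longleftrightarrow> augmented (eta1 t) (eta2 t) (v + \<alpha> *\<^sub>R direction t)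
      \<le> augmented (eta1 t) (eta2 t) v + \<alpha> * beta C * Daugmented (eta1 t) (eta2 t) v (direction t)" for v t \<alpha>
    by (simp add: armijo_def merit grad_augmented)
  have "\<exists>\<alpha>. 0 < \<alpha> \<and> \<alpha> \<le> 1 \<and> armijo P C (w \<tau>) (s \<tau>) \<alpha>" if \<tau>: "enat \<tau> < T" for \<tau>
    unfolding armijo_iff
  proof (rule armijo_step_exists[OF has_derivative_augmented _ C(2)])
    \<comment> \<open>Acceptance presupposes a KKT residual above \<open>tol_kkt C\<close>, which is
      nonnegative; hence strict descent.\<close>
    have "0 < norm (grad (lagr P) (w \<tau>))" using accepts[OF \<tau>] C by (auto simp: accepts_def)
    moreover have "0 < eta2 (s \<tau>)" using inv[OF \<tau>] shrunk_pos by blast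
    ultimately have "0 < eta2 (s \<tau>) / 2 * (norm (grad (lagr P) (w \<tau>)))\<^sup>2" by simp
    then show "Daugmented (eta1 (s \<tau>)) (eta2 (s \<tau>)) (w \<tau>) (direction (s \<tau>)) < 0"
      using desc[OF \<tau>] by simp
  qed
  moreover have "(\<lambda>\<tau>. norm (grad (lagr P) (w \<tau>))) \<longlonglongrightarrow> 0" if T: "T = \<infinity>"
  proof -
    have \<tau>: "enat \<tau> < T" for \<tau> using T by simp
    \<comment> \<open>Counts of penalty updates, chosen along the run so as to be
      nondecreasing.\<close>
    have "\<exists>m. \<forall>n. (m n \<le> m0 \<and> shrunk C a b (m n) (s n)) \<and> m n \<le> m (Suc n)"
    proof (rule dependent_nat_choice)
      show "\<exists>x. x \<le> m0 \<and> shrunk C a b x (s 0)" using inv[OF \<tau>] .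
      show "\<exists>y. (y \<le> m0 \<and> shrunk C a b y (s (Suc n))) \<and> x \<le> y" if "x \<le> m0 \<and> shrunk C a b x (s n)" for x n
        using step[OF \<tau>, of x "Suc n"] that by (auto simp: carried_def)
    qed
    then obtain m where "\<forall>n. (m n \<le> m0 \<and> shrunk C a b (m n) (s n)) \<and> m n \<le> m (Suc n)" ..
    then have m: "\<And>n. m n \<le> m0" "\<And>n. shrunk C a b (m n) (s n)" "\<And>n. m n \<le> m (Suc n)"
      by simp_all
    have fin: "finite (range m)" using m(1) by (auto intro: finite_subset[of "range m" "{..m0}"])
    \<comment> \<open>A nondecreasing sequence of naturals is constant once it attains its maximum;
      from \<open>n0\<close> on a single merit function is at work.\<close>
    then obtain n0 where n0: "m n0 = Max (range m)" using Max_in[OF fin] by fastforce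
    have const: "m (n + n0) = m n0" for n
    proof (rule antisym)
      show "m (n + n0) \<le> m n0" unfolding n0 using fin by simp
      show "m n0 \<le> m (n + n0)" using m(3) by (rule lift_Suc_mono_le) simp
    qed
    define E1 E2 where "E1 = eta1 (s n0)" and "E2 = eta2 (s n0)"
    have eta: "eta1 (s (n + n0)) = E1" "eta2 (s (n + n0)) = E2" for n
      using m(2)[of "n + n0"] m(2)[of n0] by (simp_all add: const E1_def E2_def shrunk_def)
    have "0 < E2" using shrunk_pos[OF m(2)] by (simp add: E2_def)
    have "\<forall>\<tau>. \<exists>j. armijo P C (w \<tau>) (s \<tau>) (delta C ^ j) \<and>
             (\<forall>i<j. \<not> armijo P C (w \<tau>) (s \<tau>) (delta C ^ i)) \<and>
             w (Suc \<tau>) = w \<tau> + (delta C ^ j) *\<^sub>R direction (s \<tau>)"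
      using run \<tau> by (simp add: aotd_run_def)
    then obtain j where j: "\<And>\<tau>. armijo P C (w \<tau>) (s \<tau>) (delta C ^ j \<tau>)"
      "\<And>\<tau> i. i < j \<tau> \<Longrightarrow> \<not> armijo P C (w \<tau>) (s \<tau>) (delta C ^ i)"
      "\<And>\<tau>. w (Suc \<tau>) = w \<tau> + (delta C ^ j \<tau>) *\<^sub>R direction (s \<tau>)"
      by metis
    have "frechet_derivative (augmented E1 E2) (at x) = Daugmented E1 E2 x" for x
      using frechet_derivative_at[OF has_derivative_augmented] by simp
    then have cont: "continuous_on UNIV (\<lambda>x. Daugmented E1 E2 x v)" for v
      using C1_frechet_derivative(2)[OF C1_augmented, of UNIV E1 E2 v] by simp
    have "(\<lambda>n. norm (grad (lagr P) (w (n + n0)))) \<longlonglongrightarrow> 0"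
    proof (rule backtracking_convergence[OF has_derivative_augmented cont \<open>compact K\<close> _ C(1-4)])
      show "w (n + n0) + t *\<^sub>R direction (s (n + n0)) \<in> K" if "0 \<le> t" "t \<le> 1" for n t
        using K[OF \<tau> that] .
      show "0 < E2 / 2" using \<open>0 < E2\<close> by simp
      show "Daugmented E1 E2 (w (n + n0)) (direction (s (n + n0))) \<le> - (E2 / 2) * (norm (grad (lagr P) (w (n + n0))))\<^sup>2" for n
        using desc[OF \<tau>, of "n + n0"] by (simp only: eta)
      show "augmented E1 E2 (w (n + n0) + delta C ^ j (n + n0) *\<^sub>R direction (s (n + n0)))
        \<le> augmented E1 E2 (w (n + n0)) + delta C ^ j (n + n0) * beta C * Daugmented E1 E2 (w (n + n0)) (direction (s (n + n0)))" for n
        using j(1)[of "n + n0"] by (simp only: armijo_iff eta)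
      show "\<not> augmented E1 E2 (w (n + n0) + delta C ^ i *\<^sub>R direction (s (n + n0)))
        \<le> augmented E1 E2 (w (n + n0)) + delta C ^ i * beta C * Daugmented E1 E2 (w (n + n0)) (direction (s (n + n0)))"
        if "i < j (n + n0)" for n i
        using j(2)[OF that] by (simp only: armijo_iff eta not_False_eq_True)
      show "w (Suc n + n0) = w (n + n0) + delta C ^ j (n + n0) *\<^sub>R direction (s (n + n0))" for n
        using j(3)[of "n + n0"] by simp
    qed simp
    then show ?thesis by (rule LIMSEQ_offset)
  qed
  ultimately show ?thesis by blast
qed

end
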